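(* Let $S$ be a regular local ring, $f_1,\dots,f_c$ a regular sequence in $S$ with $c>1$, $R=S/(f_1,\dots,f_c)$, and $M$ a finitely generated $R$-module. Let $G$ be the minimal $S$-free resolution of $M$, $\sigma$ a system of higher homotopies for $f_1,\dots,f_c$ on $G$, and $\mathrm{Sh}(G,\sigma)$ the associated Shamash resolution of $M$ over $R$. For every $r\ge1$ we have $$\mathbf{I}^r_\ell(\mathrm{Sh}(G,\sigma))=\mathbf{I}^r_{\ell+2}(\mathrm{Sh}(G,\sigma))\quad\text{for all } \ell\ge r\cdot\dim(S)+4(r-1)+1.$$
   Context: For a complex $(C,d)$ of finitely generated free $R$-modules, $\mathbf I^r_i(C)$ is the ideal generated by the $r\times r$ minors of $d_i:C_i\to C_{i-1}$, taken to be $0$ if $r>\operatorname{rank}C_i$ or $r>\operatorname{rank}C_{i-1}$, except that it is the unit ideal whenever $C_i=0$ or $C_{i-1}=0$. For $\mathbf a\in\mathbb Z_{\ge0}^c$ put $|\mathbf a|=\sum a_i$, and let $e_i$ be the $i$-th standard basis vector. A system of higher homotopies for $f_1,\dots,f_c$ on a complex $G$ of free $S$-modules is a family $\sigma=(\sigma_{\mathbf a})_{\mathbf a\in\mathbb Z^c_{\ge0}}$ of $S$-linear maps $\sigma_{\mathbf a}:G\to G$ of homological degree $2|\mathbf a|-1$ (not necessarily chain maps) such that: (a) $\sigma_0$ is the differential of $G$; (b) $\sigma_0\sigma_{e_i}+\sigma_{e_i}\sigma_0=f_i\cdot\mathrm{id}_G$ for $1\le i\le c$; (c) $\sum_{\mathbf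 u+\mathbf v=\mathbf a}\sigma_{\mathbf u}\sigma_{\mathbf v}=0$ whenever $|\mathbf a|\ge2$. Let $\widetilde D$ be the graded $S$-dual of $S[t_1,\dots,t_c]$ ($\deg t_i=-2$), i.e. the divided power algebra with $S$-basis $y^{(\mathbf b)}$, $\mathbf b\in\mathbb Z^c_{\ge0}$, of degree $2|\mathbf b|$, on which $t^{\mathbf a}$ acts by $t^{\mathbf a}y^{(\mathbf b)}=y^{(\mathbf b-\mathbf a)}$ if $\mathbf b-\mathbf a\ge0$ and $0$ otherwise. $\mathrm{Sh}(G,\sigma)$ is the graded $R$-module $\widetilde D\otimes_SG\otimes_SR$ with differential $\sum_{\mathbf a}t^{\mathbf a}\otimes\sigma_{\mathbf a}\otimes\mathrm{id}$; in this situation it is an $R$-free resolution of $M$ (not necessarily minimal). *)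

theory Defs
  imports
    "Jordan_Normal_Form.Determinant"
    "HOL-Library.Poly_Mapping"
    "HOL-Library.Extended_Nat"
    "HOL-Library.Disjoint_Sets"
begin

section \<open>Ideals and regular local rings\<close>

text \<open>
  An ideal of a commutative ring is a submodule of the ring regarded as a module over itself.
  The qualified names refer to the type-class based modules of \<open>HOL.Modules\<close>; \<open>HOL-Algebra\<close> has
  a record-based locale of the same name.
\<close>

lemma module_mult_self: "Modules.module ((*) :: 'a::comm_ring_1 \<Rightarrow> 'a \<Rightarrow> 'a)"
  by unfold_locales (auto simp: algebra_simps)

definition ring_ideal :: "'a::comm_ring_1 set \<Rightarrow> bool" where
  "ring_ideal I \<longleftrightarrow> Modules.module.subspace (*) I"

definition ideal_gen :: "'a::comm_ring_1 set \<Rightarrow> 'a set" where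
  "ideal_gen X = Modules.module.span (*) X"

definition prime_ideal :: "'a::comm_ring_1 set \<Rightarrow> bool" where
  "prime_ideal P \<longleftrightarrow> ring_ideal P \<and> P \<noteq> UNIV \<and> (\<forall>x y. x * y \<in> P \<longrightarrow> x \<in> P \<or> y \<in> P)"

definition maximal_ideal :: "'a::comm_ring_1 set \<Rightarrow> bool" where
  "maximal_ideal I \<longleftrightarrow>
     ring_ideal I \<and> I \<noteq> UNIV \<and> (\<forall>J. ring_ideal J \<longrightarrow> I \<subseteq> J \<longrightarrow> J = I \<or> J = UNIV)"

definition noetherian :: "'a::comm_ring_1 itself \<Rightarrow> bool" where
  "noetherian _ \<longleftrightarrow> (\<forall>I::'a set. ring_ideal I \<longrightarrow> (\<exists>X. finite X \<and> ideal_gen X = I))"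

definition krull_dim :: "'a::comm_ring_1 itself \<Rightarrow> enat" where
  "krull_dim _ = Sup {enat n | n. \<exists>P :: nat \<Rightarrow> 'a set.
     (\<forall>i\<le>n. prime_ideal (P i)) \<and> (\<forall>i<n. P i \<subset> P (Suc i))}"

definition local_ring :: "'a::comm_ring_1 set \<Rightarrow> bool" where
  "local_ring \<mm> \<longleftrightarrow> maximal_ideal \<mm> \<and> (\<forall>\<nn>. maximal_ideal \<nn> \<longrightarrow> \<nn> = \<mm>)"

definition regular_local_ring :: "'a::comm_ring_1 set \<Rightarrow> bool" where
  "regular_local_ring \<mm> \<longleftrightarrow> noetherian TYPE('a) \<and> local_ring \<mm> \<and>
     (\<exists>X. finite X \<and> enat (card X) = krull_dim TYPE('a) \<and> ideal_gen X = \<mm>)"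

text \<open>The sequence is \<open>f 0, \<dots>, f (c - 1)\<close>.\<close>

definition regular_sequence :: "(nat \<Rightarrow> 'a::comm_ring_1) \<Rightarrow> nat \<Rightarrow> bool" where
  "regular_sequence f c \<longleftrightarrow>
     (\<forall>i<c. \<forall>x. f i * x \<in> ideal_gen (f ` {..<i}) \<longrightarrow> x \<in> ideal_gen (f ` {..<i})) \<and>
     ideal_gen (f ` {..<c}) \<noteq> UNIV"

text \<open>
  A quotient ring cannot be a type depending on \<open>I\<close>; it is given by its projection, which
  determines it up to unique isomorphism under the original ring.
\<close>

definition quotient_projection :: "('s::comm_ring_1 \<Rightarrow> 'r::comm_ring_1) \<Rightarrow> 's set \<Rightarrow> bool" where
  "quotient_projection \<pi> I \<longleftrightarrow> comm_ring_hom \<pi> \<and> surj \<pi> \<and> {s. \<pi> s = 0} = I"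

definition fin_gen_module :: "('r::comm_ring_1 \<Rightarrow> 'm::ab_group_add \<Rightarrow> 'm) \<Rightarrow> bool" where
  "fin_gen_module sc \<longleftrightarrow>
     Modules.module sc \<and> (\<exists>X. finite X \<and> Modules.module.span sc X = UNIV)"


section \<open>Graded free modules, minors and minimal free resolutions\<close>

text \<open>
  A graded free module with finitely generated pieces is given by a scalar multiplication \<open>sc\<close> and
  homogeneous bases: \<open>B j\<close> is a finite basis of the piece of degree \<open>j\<close>.  That piece is the span of
  \<open>B j\<close>, and the graded module is the direct sum of the pieces inside the ambient type.
\<close>

definition graded_free ::
  "('a::comm_ring_1 \<Rightarrow> 'v::ab_group_add \<Rightarrow> 'v) \<Rightarrow> (int \<Rightarrow> 'v set) \<Rightarrow> bool" where
  "graded_free sc B \<longleftrightarrow> Modules.module sc \<and> (\<forall>j. finite (B j)) \<and> disjoint_family B \<and>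
     \<not> Modules.module.dependent sc (\<Union>j. B j)"

text \<open>
  The ideal of \<open>r \<times> r\<close> minors of the component \<open>d\<^sub>i\<close> of a differential, from degree \<open>i\<close> to degree
  \<open>i - 1\<close>, computed from its matrix with respect to the given bases (the ideal does not depend on
  them).  The lists \<open>rs\<close> and \<open>cs\<close> select rows and columns; their order only affects the sign of a
  minor.  If \<open>r\<close> exceeds one of the two ranks, there are no minors and the ideal is \<open>0\<close>.
\<close>

definition minors :: "('a::comm_ring_1 \<Rightarrow> 'v::ab_group_add \<Rightarrow> 'v) \<Rightarrow> (int \<Rightarrow> 'v set) \<Rightarrow>
    ('v \<Rightarrow> 'v) \<Rightarrow> nat \<Rightarrow> int \<Rightarrow> 'a set" where
  "minors sc B d r i =
     {det (mat r r (\<lambda>(p, q). Modules.module.representation sc (\<Union>j. B j) (d (cs ! q)) (rs ! p))) | rs cs.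
        length rs = r \<and> distinct rs \<and> set rs \<subseteq> B (i - 1) \<and>
        length cs = r \<and> distinct cs \<and> set cs \<subseteq> B i}"

definition minor_ideal :: "('a::comm_ring_1 \<Rightarrow> 'v::ab_group_add \<Rightarrow> 'v) \<Rightarrow> (int \<Rightarrow> 'v set) \<Rightarrow>
    ('v \<Rightarrow> 'v) \<Rightarrow> nat \<Rightarrow> int \<Rightarrow> 'a set" where
  "minor_ideal sc B d r i =
     (if B i = {} \<or> B (i - 1) = {} then UNIV else ideal_gen (minors sc B d r i))"

lemma minor_ideal_exceeding_rank:
  assumes "graded_free sc B" and "B i \<noteq> {}" and "B (i - 1) \<noteq> {}"
    and "r > card (B i) \<or> r > card (B (i - 1))"
  shows "minor_ideal sc B d r i = {0}"
proof -
  have len: "length xs \<le> card (B j)" if "distinct xs" "set xs \<subseteq> B j" for xs j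
  proof -
    have "finite (B j)" using assms(1) by (simp add: graded_free_def)
    then have "card (set xs) \<le> card (B j)" using that(2) by (rule card_mono)
    then show ?thesis using distinct_card[OF that(1)] by simp
  qed
  have "\<not> (length rs = r \<and> distinct rs \<and> set rs \<subseteq> B (i - 1) \<and>
      length cs = r \<and> distinct cs \<and> set cs \<subseteq> B i)" for rs cs
    using len[of rs "i - 1"] len[of cs i] assms(4) by linarith
  then have "minors sc B d r i = {}"
    unfolding minors_def by blast
  then show ?thesis
    using assms(2,3) Modules.module.span_empty[OF module_mult_self]
    by (simp add: minor_ideal_def ideal_gen_def)
qed

text \<open>
  A minimal free resolution over a local ring with maximal ideal \<open>\<mm>\<close>.  The type \<open>'g\<close> is the whole
  graded module \<open>G\<close>, and \<open>M\<close> is the type \<open>'m\<close> with scalar multiplication \<open>scM\<close>.  The last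
  condition is minimality, \<open>d(G) \<subseteq> \<mm>G\<close>.
\<close>

definition minimal_free_resolution ::
  "'s::comm_ring_1 set \<Rightarrow> ('s \<Rightarrow> 'g::ab_group_add \<Rightarrow> 'g) \<Rightarrow> (int \<Rightarrow> 'g set) \<Rightarrow> ('g \<Rightarrow> 'g) \<Rightarrow>
   ('s \<Rightarrow> 'm::ab_group_add \<Rightarrow> 'm) \<Rightarrow> ('g \<Rightarrow> 'm) \<Rightarrow> bool" where
  "minimal_free_resolution \<mm> sc B d scM \<epsilon> \<longleftrightarrow>
     graded_free sc B \<and> Modules.module.span sc (\<Union>j. B j) = UNIV \<and> (\<forall>j<0. B j = {}) \<and>
     module_hom sc sc d \<and>
     (\<forall>j. d ` Modules.module.span sc (B j) \<subseteq> Modules.module.span sc (B (j - 1))) \<and>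
     (\<forall>j\<ge>1. {x \<in> Modules.module.span sc (B j). d x = 0} = d ` Modules.module.span sc (B (j + 1))) \<and>
     module_hom sc scM \<epsilon> \<and>
     \<epsilon> ` Modules.module.span sc (B 0) = UNIV \<and>
     {x \<in> Modules.module.span sc (B 0). \<epsilon> x = 0} = d ` Modules.module.span sc (B 1) \<and>
     range d \<subseteq> Modules.module.span sc {sc s x | s x. s \<in> \<mm>}"


section \<open>Higher homotopies and the Shamash resolution\<close>

text \<open>
  Elements of \<open>\<int>\<^sub>\<ge>\<^sub>0\<^sup>c\<close> are finitely supported functions with support in \<open>{0, \<dots>, c - 1}\<close>; the
  basis vector \<open>e\<^sub>i\<close> is \<open>Poly_Mapping.single i 1\<close>.
\<close>

type_synonym multi_index = "nat \<Rightarrow>\<^sub>0 nat"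

definition multi_indices :: "nat \<Rightarrow> multi_index set" where
  "multi_indices c = {a. Poly_Mapping.keys a \<subseteq> {..<c}}"

definition mdeg :: "multi_index \<Rightarrow> nat" where
  "mdeg a = (\<Sum>i\<in>Poly_Mapping.keys a. Poly_Mapping.lookup a i)"

lemma finite_splittings: "finite {(u, v). u + v = (a :: multi_index)}"
proof -
  define F where "F = {g :: nat \<Rightarrow> nat. \<forall>i.
    (i \<in> Poly_Mapping.keys a \<longrightarrow> g i \<in> {..Max (range (Poly_Mapping.lookup a))}) \<and>
    (i \<notin> Poly_Mapping.keys a \<longrightarrow> g i = 0)}"
  have fin_range: "finite (range (Poly_Mapping.lookup a))"
  proof (rule finite_subset)
    show "range (Poly_Mapping.lookup a) \<subseteq> insert 0 (Poly_Mapping.lookup a ` Poly_Mapping.keys a)"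
      by (auto simp: in_keys_iff)
  qed simp
  have "finite F"
    unfolding F_def by (rule finite_set_of_finite_funs) simp_all
  have *: "Poly_Mapping.lookup u \<in> F" if "\<And>i. Poly_Mapping.lookup u i \<le> Poly_Mapping.lookup a i" for u
  proof -
    have "Poly_Mapping.lookup u i \<le> Max (range (Poly_Mapping.lookup a))" for i
      using that[of i] Max_ge[OF fin_range, of "Poly_Mapping.lookup a i"] by auto
    moreover have "Poly_Mapping.lookup u i = 0" if "i \<notin> Poly_Mapping.keys a" for i
      using that \<open>\<And>i. Poly_Mapping.lookup u i \<le> Poly_Mapping.lookup a i\<close>[of i] by (simp add: in_keys_iff)
    ultimately show ?thesis by (auto simp: F_def)
  qed
  have "{(u, v). u + v = a} \<subseteq> (Poly_Mapping.lookup -` F) \<times> (Poly_Mapping.lookup -` F)"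
    by (auto simp: lookup_add intro!: *)
  moreover have "finite (Poly_Mapping.lookup -` F)"
    using \<open>finite F\<close> by (rule finite_vimageI) (auto intro!: injI poly_mapping_eqI)
  ultimately show ?thesis
    using finite_subset by blast
qed

definition higher_homotopies ::
  "(nat \<Rightarrow> 's::comm_ring_1) \<Rightarrow> nat \<Rightarrow> ('s \<Rightarrow> 'g::ab_group_add \<Rightarrow> 'g) \<Rightarrow> (int \<Rightarrow> 'g set) \<Rightarrow>
   ('g \<Rightarrow> 'g) \<Rightarrow> (multi_index \<Rightarrow> 'g \<Rightarrow> 'g) \<Rightarrow> bool" where
  "higher_homotopies f c sc B d \<sigma> \<longleftrightarrow>
     (\<forall>a\<in>multi_indices c. module_hom sc sc (\<sigma> a) \<and>
        (\<forall>j. \<sigma> a ` Modules.module.span sc (B j) \<subseteq>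
           Modules.module.span sc (B (j + 2 * int (mdeg a) - 1)))) \<and>
     \<sigma> 0 = d \<and>
     (\<forall>i<c. \<forall>x. \<sigma> 0 (\<sigma> (Poly_Mapping.single i 1) x) + \<sigma> (Poly_Mapping.single i 1) (\<sigma> 0 x)
        = sc (f i) x) \<and>
     (\<forall>a\<in>multi_indices c. mdeg a \<ge> 2 \<longrightarrow>
        (\<forall>x. (\<Sum>(u, v)\<in>{(u, v). u + v = a}. \<sigma> u (\<sigma> v x)) = 0))"

text \<open>
  The \<open>R\<close>-module underlying the Shamash complex is free on the elements \<open>y\<^sup>(\<^sup>b\<^sup>) \<otimes> e \<otimes> 1\<close>, where
  \<open>b\<close> is a multi-index and \<open>e\<close> runs through the basis of \<open>G\<close>.  It is realised inside the free module
  on all pairs \<open>(b, e)\<close>, the pair standing for that tensor.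
\<close>

type_synonym ('g, 'r) shamash = "(multi_index \<times> 'g) \<Rightarrow>\<^sub>0 'r"

definition sh_scale :: "'r::comm_ring_1 \<Rightarrow> ('g, 'r) shamash \<Rightarrow> ('g, 'r) shamash" where
  "sh_scale s = Poly_Mapping.map ((*) s)"

definition sh_basis :: "nat \<Rightarrow> (int \<Rightarrow> 'g set) \<Rightarrow> int \<Rightarrow> ('g, 'r::comm_ring_1) shamash set" where
  "sh_basis c B l = {Poly_Mapping.single (b, e) 1 | b e.
     b \<in> multi_indices c \<and> e \<in> B (l - 2 * int (mdeg b))}"

text \<open>\<open>sh_tensor \<pi> sc B b g\<close> is \<open>y\<^sup>(\<^sup>b\<^sup>) \<otimes> g \<otimes> 1\<close> for an arbitrary \<open>g\<close> in \<open>G\<close>.\<close>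

definition sh_tensor :: "('s::comm_ring_1 \<Rightarrow> 'r::comm_ring_1) \<Rightarrow> ('s \<Rightarrow> 'g::ab_group_add \<Rightarrow> 'g) \<Rightarrow>
    (int \<Rightarrow> 'g set) \<Rightarrow> multi_index \<Rightarrow> 'g \<Rightarrow> ('g, 'r) shamash" where
  "sh_tensor \<pi> sc B b g =
     (\<Sum>e | Modules.module.representation sc (\<Union>j. B j) g e \<noteq> 0.
        Poly_Mapping.single (b, e) (\<pi> (Modules.module.representation sc (\<Union>j. B j) g e)))"

text \<open>
  The differential is the \<open>R\<close>-linear map with
  \<open>y\<^sup>(\<^sup>b\<^sup>) \<otimes> e \<otimes> 1 \<mapsto> \<Sum>\<^sub>a t\<^sup>a y\<^sup>(\<^sup>b\<^sup>) \<otimes> \<sigma>\<^sub>a(e) \<otimes> 1\<close>.  Since \<open>t\<^sup>a y\<^sup>(\<^sup>b\<^sup>)\<close> is \<open>y\<^sup>(\<^sup>b\<^sup>-\<^sup>a\<^sup>)\<close> if \<open>a \<le> b\<close> and \<open>0\<close>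
  otherwise, only the pairs \<open>(a, b')\<close> with \<open>a + b' = b\<close> contribute.
\<close>

definition sh_diff :: "('s::comm_ring_1 \<Rightarrow> 'r::comm_ring_1) \<Rightarrow> ('s \<Rightarrow> 'g::ab_group_add \<Rightarrow> 'g) \<Rightarrow>
    (int \<Rightarrow> 'g set) \<Rightarrow> (multi_index \<Rightarrow> 'g \<Rightarrow> 'g) \<Rightarrow> ('g, 'r) shamash \<Rightarrow> ('g, 'r) shamash" where
  "sh_diff \<pi> sc B \<sigma> x =
     (\<Sum>(b, e)\<in>Poly_Mapping.keys x. sh_scale (Poly_Mapping.lookup x (b, e))
        (\<Sum>(a, b')\<in>{(a, b'). a + b' = b}. sh_tensor \<pi> sc B b' (\<sigma> a e)))"

lemma lookup_sh_scale: "Poly_Mapping.lookup (sh_scale s x) k = s * Poly_Mapping.lookup x k"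
  by (auto simp: sh_scale_def Poly_Mapping.map.rep_eq when_def)

lemma module_sh_scale:
  "Modules.module (sh_scale :: 'r::comm_ring_1 \<Rightarrow> ('g, 'r) shamash \<Rightarrow> ('g, 'r) shamash)"
proof
  fix a b :: 'r and x y :: "('g, 'r) shamash"
  show "sh_scale a (x + y) = sh_scale a x + sh_scale a y"
    by (rule poly_mapping_eqI) (simp add: lookup_sh_scale lookup_add distrib_left)
  show "sh_scale (a + b) x = sh_scale a x + sh_scale b x"
    by (rule poly_mapping_eqI) (simp add: lookup_sh_scale lookup_add distrib_right)
  show "sh_scale a (sh_scale b x) = sh_scale (a * b) x"
    by (rule poly_mapping_eqI) (simp add: lookup_sh_scale mult.assoc)
  show "sh_scale 1 x = x"
    by (rule poly_mapping_eqI) (simp add: lookup_sh_scale)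
qed

lemma finite_multi_indices_bounded: "finite {b \<in> multi_indices c. mdeg b \<le> n}"
proof -
  define F where "F = {g :: nat \<Rightarrow> nat. \<forall>i. (i \<in> {..<c} \<longrightarrow> g i \<in> {..n}) \<and> (i \<notin> {..<c} \<longrightarrow> g i = 0)}"
  have "finite F"
    unfolding F_def by (rule finite_set_of_finite_funs) simp_all
  have le: "Poly_Mapping.lookup b i \<le> mdeg b" for b i
  proof (cases "i \<in> Poly_Mapping.keys b")
    case True
    then show ?thesis
      unfolding mdeg_def by (intro member_le_sum) auto
  qed (simp add: in_keys_iff)
  have "{b \<in> multi_indices c. mdeg b \<le> n} \<subseteq> Poly_Mapping.lookup -` F"
  proof
    fix b assume b: "b \<in> {b \<in> multi_indices c. mdeg b \<le> n}"
    then have "Poly_Mapping.lookup b i \<le> n" for i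
      using le[of b i] by auto
    moreover have "Poly_Mapping.lookup b i = 0" if "i \<notin> {..<c}" for i
      using b that by (auto simp: multi_indices_def in_keys_iff)
    ultimately show "b \<in> Poly_Mapping.lookup -` F"
      by (simp add: F_def)
  qed
  moreover have "finite (Poly_Mapping.lookup -` F)"
    using \<open>finite F\<close> by (rule finite_vimageI) (auto intro!: injI poly_mapping_eqI)
  ultimately show ?thesis
    using finite_subset by blast
qed

lemma graded_free_shamash:
  assumes "graded_free sc B" and "\<forall>j<0. B j = {}"
  shows "graded_free sh_scale (sh_basis c B :: int \<Rightarrow> ('g::ab_group_add, 'r::comm_ring_1) shamash set)"
proof -
  interpret sh: Modules.module "sh_scale :: 'r \<Rightarrow> ('g, 'r) shamash \<Rightarrow> ('g, 'r) shamash"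
    by (rule module_sh_scale)
  let ?S = "\<lambda>k. Poly_Mapping.single k 1 :: ('g, 'r) shamash"
  let ?B = "sh_basis c B :: int \<Rightarrow> ('g, 'r) shamash set"
  have inj: "?S k = ?S k' \<longleftrightarrow> k = k'" for k k'
  proof
    assume "?S k = ?S k'"
    then have "Poly_Mapping.lookup (?S k) k = Poly_Mapping.lookup (?S k') k" by simp
    then show "k = k'" by (simp add: lookup_single when_def split: if_splits)
  qed simp
  have "finite (?B l)" for l
  proof -
    have "?B l \<subseteq> ?S ` (SIGMA b:{b \<in> multi_indices c. mdeg b \<le> nat l}. B (l - 2 * int (mdeg b)))"
    proof
      fix x assume "x \<in> ?B l"
      then obtain b e where *: "x = ?S (b, e)" "b \<in> multi_indices c" "e \<in> B (l - 2 * int (mdeg b))"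
        by (auto simp: sh_basis_def)
      then have "\<not> l - 2 * int (mdeg b) < 0" using assms(2) by auto
      then have "mdeg b \<le> nat l" by linarith
      with * show "x \<in> ?S ` (SIGMA b:{b \<in> multi_indices c. mdeg b \<le> nat l}. B (l - 2 * int (mdeg b)))"
        by auto
    qed
    moreover have "finite (SIGMA b:{b \<in> multi_indices c. mdeg b \<le> nat l}. B (l - 2 * int (mdeg b)))"
      using finite_multi_indices_bounded assms(1) by (intro finite_SigmaI) (auto simp: graded_free_def)
    ultimately show ?thesis
      using finite_surj by blast
  qed
  moreover have "disjoint_family ?B"
    unfolding disjoint_family_on_def
  proof (intro ballI impI)
    fix l l' :: int assume "l \<noteq> l'"
    then have "B (l - 2 * int k) \<inter> B (l' - 2 * int k) = {}" for k
      using assms(1) by (auto simp: graded_free_def disjoint_family_on_def)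
    then show "?B l \<inter> ?B l' = {}"
      unfolding sh_basis_def by (auto simp: inj disjoint_iff)
  qed
  moreover have "sh.independent (\<Union>l. ?B l)"
    unfolding sh.independent_explicit_module
  proof (intro allI impI, rule ccontr)
    fix t :: "('g, 'r) shamash set" and u v
    assume t: "finite t" "t \<subseteq> (\<Union>l. ?B l)" and z: "(\<Sum>v\<in>t. sh_scale (u v) v) = 0" and v: "v \<in> t"
      and "u v \<noteq> 0"
    have form: "\<exists>k. w = ?S k" if "w \<in> t" for w
      using subsetD[OF t(2) that] unfolding sh_basis_def by blast
    then obtain k where k: "v = ?S k" using v by blast
    have "0 = Poly_Mapping.lookup (\<Sum>w\<in>t. sh_scale (u w) w) k" by (simp add: z)
    also have "\<dots> = (\<Sum>w\<in>t. u w * Poly_Mapping.lookup w k)"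
      by (simp add: lookup_sum lookup_sh_scale)
    also have "\<dots> = (\<Sum>w\<in>t. if w = v then u w else 0)"
    proof (rule sum.cong)
      fix w assume "w \<in> t"
      then obtain k' where "w = ?S k'" using form by blast
      then show "u w * Poly_Mapping.lookup w k = (if w = v then u w else 0)"
        by (auto simp: k inj lookup_single when_def)
    qed simp
    also have "\<dots> = u v" using t v by simp
    finally show False using \<open>u v \<noteq> 0\<close> by simp
  qed
  ultimately show ?thesis
    unfolding graded_free_def using module_sh_scale by blast
qed

end

theory Submission
  imports Defs
begin

text \<open>
  With respect to the bases \<open>y\<^sup>(\<^sup>b\<^sup>) \<otimes> e\<close>, the matrix of the differential of the Shamash complex has
  a Toeplitz form: the entry in row \<open>(b', e')\<close> and column \<open>(b, e)\<close> is the coefficient of \<open>e'\<close> in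
  \<open>\<sigma>\<^sub>a(e)\<close> with \<open>a = b - b'\<close>, and it is zero unless \<open>b' \<le> b\<close>.  Translating all multi-indices of a
  minor by a unit vector therefore turns a minor in degree \<open>l\<close> into an equal one in degree \<open>l + 2\<close>
  (\<open>toeplitz_minors_mono\<close>).

  For the converse, a nonzero minor in degree \<open>l + 2\<close> has to be found in degree \<open>l\<close>.  The minimal
  resolution \<open>G\<close> is concentrated in degrees from \<open>0\<close> to \<open>d = dim S\<close>
  (\<open>minimal_free_resolution_length_le_dim\<close>).  So a nonzero entry has \<open>|b - b'| \<le> (d + 1) / 2\<close>, whereas
  in degree \<open>l\<close> all multi-indices have size about \<open>l / 2\<close>.  The connected components of the bipartite
  graph of nonzero entries then have room to be translated individually.  Translating them one
  step down could make them interact; but since \<open>c > 1\<close> they can be arranged along the first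
  coordinate such that the new matrix is block triangular with the same diagonal blocks, hence has the
  same determinant (\<open>toeplitz_det_translate\<close>).

  The length of the resolution is bounded without derived functors.  A minimal system of generators of the maximal
  ideal of a regular local ring is a regular sequence
  (\<open>regular_local_ring_regular_sequence\<close>), and reducing a complex modulo one member of such a sequence
  shifts the range of exactness by one degree (\<open>exact_modulo_regular_sequence\<close>); modulo all of them
  the differential of \<open>G\<close> vanishes.  The regularity of the generators comes from dimension theory, by
  way of Krull's principal ideal theorem (\<open>krull_principal_ideal\<close>).  Quotients and localisations of
  the ring are expressed by ideals throughout.
\<close>

section \<open>Ideals of noetherian rings\<close>

lemma ring_ideal_iff:
  "ring_ideal I \<longleftrightarrow> 0 \<in> I \<and> (\<forall>x\<in>I. \<forall>y\<in>I. x + y \<in> I) \<and> (\<forall>c. \<forall>x\<in>I. c * x \<in> I)"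
  by (simp add: ring_ideal_def Modules.module.subspace_def[OF module_mult_self])

lemma ring_ideal_0: "ring_ideal I \<Longrightarrow> 0 \<in> I"
  and ring_ideal_add: "ring_ideal I \<Longrightarrow> x \<in> I \<Longrightarrow> y \<in> I \<Longrightarrow> x + y \<in> I"
  and ring_ideal_mult: "ring_ideal I \<Longrightarrow> x \<in> I \<Longrightarrow> c * x \<in> I"
  by (auto simp: ring_ideal_iff)

lemma ring_ideal_mult_right: "ring_ideal I \<Longrightarrow> x \<in> I \<Longrightarrow> x * c \<in> I"
  by (metis ring_ideal_mult mult.commute)

lemma ring_ideal_uminus: "ring_ideal I \<Longrightarrow> x \<in> I \<Longrightarrow> - x \<in> I"
  using ring_ideal_mult[of I x "- 1"] by simp

lemma ring_ideal_diff: "ring_ideal I \<Longrightarrow> x \<in> I \<Longrightarrow> y \<in> I \<Longrightarrow> x - y \<in> I"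
  using ring_ideal_add[of I x "- y"] ring_ideal_uminus[of I y] by simp

lemma ring_ideal_sum: "ring_ideal I \<Longrightarrow> (\<And>i. i \<in> A \<Longrightarrow> g i \<in> I) \<Longrightarrow> sum g A \<in> I"
  by (induct A rule: infinite_finite_induct) (auto simp: ring_ideal_0 ring_ideal_add)

lemma ring_ideal_eq_UNIV: "ring_ideal I \<Longrightarrow> 1 \<in> I \<Longrightarrow> I = UNIV"
  using ring_ideal_mult[of I 1] by fastforce

lemma ring_ideal_ideal_gen: "ring_ideal (ideal_gen X)"
  by (simp add: ring_ideal_def ideal_gen_def Modules.module.subspace_span[OF module_mult_self])

lemma ideal_gen_base: "x \<in> X \<Longrightarrow> x \<in> ideal_gen X"
  by (simp add: ideal_gen_def Modules.module.span_base[OF module_mult_self])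

lemma ideal_gen_minimal: "X \<subseteq> I \<Longrightarrow> ring_ideal I \<Longrightarrow> ideal_gen X \<subseteq> I"
  by (simp add: ring_ideal_def ideal_gen_def Modules.module.span_minimal[OF module_mult_self])

lemma ideal_gen_mono: "X \<subseteq> Y \<Longrightarrow> ideal_gen X \<subseteq> ideal_gen Y"
  by (simp add: ideal_gen_def Modules.module.span_mono[OF module_mult_self])

lemma ideal_gen_ideal: "ring_ideal I \<Longrightarrow> ideal_gen I = I"
  by (simp add: ring_ideal_def ideal_gen_def Modules.module.span_eq_iff[OF module_mult_self])

lemma in_ideal_gen_insert: "x \<in> ideal_gen (insert a X) \<longleftrightarrow> (\<exists>k. x - k * a \<in> ideal_gen X)"
  by (simp add: ideal_gen_def Modules.module.span_insert[OF module_mult_self])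

lemma in_ideal_gen_insert_ideal:
  "ring_ideal I \<Longrightarrow> x \<in> ideal_gen (insert a I) \<longleftrightarrow> (\<exists>k. x - k * a \<in> I)"
  by (simp add: in_ideal_gen_insert ideal_gen_ideal)

lemma in_ideal_gen_Un:
  "ring_ideal I \<Longrightarrow> ring_ideal J \<Longrightarrow> x \<in> ideal_gen (I \<union> J) \<longleftrightarrow> (\<exists>i\<in>I. \<exists>j\<in>J. x = i + j)"
  using Modules.module.span_Un[OF module_mult_self, of I J] ideal_gen_ideal[of I] ideal_gen_ideal[of J]
  unfolding ideal_gen_def by auto

lemma ideal_gen_Un_gen: "ideal_gen (ideal_gen X \<union> Y) = ideal_gen (X \<union> Y)"
proof
  show "ideal_gen (ideal_gen X \<union> Y) \<subseteq> ideal_gen (X \<union> Y)"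
    by (intro ideal_gen_minimal ring_ideal_ideal_gen Un_least ideal_gen_mono) (auto intro: ideal_gen_base)
  show "ideal_gen (X \<union> Y) \<subseteq> ideal_gen (ideal_gen X \<union> Y)"
    by (rule ideal_gen_mono) (auto intro: ideal_gen_base)
qed

lemma prime_ideal_ideal: "prime_ideal P \<Longrightarrow> ring_ideal P"
  by (simp add: prime_ideal_def)

lemma prime_idealD: "prime_ideal P \<Longrightarrow> x * y \<in> P \<Longrightarrow> x \<in> P \<or> y \<in> P"
  by (simp add: prime_ideal_def)

lemma prime_ideal_one: "prime_ideal P \<Longrightarrow> 1 \<notin> P"
  using ring_ideal_eq_UNIV by (auto simp: prime_ideal_def)

lemma prime_ideal_compl_mult: "prime_ideal P \<Longrightarrow> x \<notin> P \<Longrightarrow> y \<notin> P \<Longrightarrow> x * y \<notin> P"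
  by (auto simp: prime_ideal_def)

text \<open>
  The union of a chain of ideals is generated by finitely many elements, and these already lie in
  one member of the chain; so Zorn's lemma applies to any nonempty family of ideals.
\<close>

lemma noetherian_maximal_member:
  fixes F :: "'a::comm_ring_1 set set"
  assumes noeth: "noetherian TYPE('a)" and ne: "F \<noteq> {}" and ideals: "\<And>I. I \<in> F \<Longrightarrow> ring_ideal I"
  obtains M where "M \<in> F" "\<And>I. I \<in> F \<Longrightarrow> M \<subseteq> I \<Longrightarrow> I = M"
proof -
  have "\<Union>C \<in> F" if C: "C \<noteq> {}" "subset.chain F C" for C
  proof -
    have CF: "C \<subseteq> F" and lin: "\<And>I J. I \<in> C \<Longrightarrow> J \<in> C \<Longrightarrow> I \<subseteq> J \<or> J \<subseteq> I"
      using C(2) by (auto simp: subset_chain_def)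
    have "ring_ideal (\<Union>C)"
      unfolding ring_ideal_iff
    proof (intro conjI ballI allI)
      show "0 \<in> \<Union>C" using C(1) CF ideals ring_ideal_0 by blast
      show "c * x \<in> \<Union>C" if "x \<in> \<Union>C" for c x
        using that CF ideals ring_ideal_mult by blast
      fix x y assume "x \<in> \<Union>C" "y \<in> \<Union>C"
      then obtain I J where "I \<in> C" "x \<in> I" "J \<in> C" "y \<in> J" by blast
      then show "x + y \<in> \<Union>C"
        using lin[of I J] CF ideals ring_ideal_add by blast
    qed
    then obtain X where X: "finite X" "ideal_gen X = \<Union>C"
      using noeth unfolding noetherian_def by blast
    then have "X \<subseteq> \<Union>C" using ideal_gen_base by blast
    then obtain I where I: "I \<in> C" "X \<subseteq> I"
      using finite_subset_Union_chain[OF X(1) _ C] by blast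
    then have "\<Union>C \<subseteq> I" using X(2) ideal_gen_minimal[of X I] CF ideals by blast
    then have "\<Union>C = I" using I by blast
    then show ?thesis using I CF by blast
  qed
  then show ?thesis using subset_Zorn_nonempty[OF ne] that by metis
qed

section \<open>Krull's principal ideal theorem\<close>

text \<open>
  The preimage in the ring of the extension of \<open>I\<close> to the localisation at the prime \<open>P\<close>.  Ideals
  that are equal to their saturation correspond to the ideals of the localisation, so that
  statements about the localisation can be made without introducing it as a type.
\<close>

definition saturation :: "'a::comm_ring_1 set \<Rightarrow> 'a set \<Rightarrow> 'a set" where
  "saturation P I = {a. \<exists>u. u \<notin> P \<and> u * a \<in> I}"

lemma saturationI: "u \<notin> P \<Longrightarrow> u * a \<in> I \<Longrightarrow> a \<in> saturation P I"
  by (auto simp: saturation_def)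

lemma saturationE:
  assumes "a \<in> saturation P I" obtains u where "u \<notin> P" "u * a \<in> I"
  using assms by (auto simp: saturation_def)

lemma saturation_superset: "prime_ideal P \<Longrightarrow> I \<subseteq> saturation P I"
  by (auto intro!: saturationI[of 1] dest: prime_ideal_one)

lemma saturation_mono: "I \<subseteq> J \<Longrightarrow> saturation P I \<subseteq> saturation P J"
  by (auto simp: saturation_def)

lemma saturation_idem: "prime_ideal P \<Longrightarrow> saturation P (saturation P I) = saturation P I"
proof
  assume P: "prime_ideal P"
  show "saturation P (saturation P I) \<subseteq> saturation P I"
  proof
    fix a assume "a \<in> saturation P (saturation P I)"
    then obtain u v where "u \<notin> P" "v \<notin> P" "v * (u * a) \<in> I" by (auto simp: saturation_def)
    then show "a \<in> saturation P I"
      using prime_ideal_compl_mult[OF P, of v u] by (intro saturationI[of "v * u"]) (auto simp: mult.assoc)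
  qed
qed (rule saturation_superset)

lemma ring_ideal_saturation:
  assumes "prime_ideal P" "ring_ideal I" shows "ring_ideal (saturation P I)"
  unfolding ring_ideal_iff
proof (intro conjI ballI allI)
  show "0 \<in> saturation P I"
    using assms saturation_superset ring_ideal_0 by blast
  show "c * x \<in> saturation P I" if "x \<in> saturation P I" for c x
    using that ring_ideal_mult[OF assms(2)] by (fastforce simp: saturation_def mult.left_commute[of _ c])
  fix x y assume "x \<in> saturation P I" "y \<in> saturation P I"
  then obtain u v where uv: "u \<notin> P" "u * x \<in> I" "v \<notin> P" "v * y \<in> I" by (auto simp: saturation_def)
  have "u * v * (x + y) = v * (u * x) + u * (v * y)" by (simp add: algebra_simps)
  then have "u * v * (x + y) \<in> I" using uv assms(2) by (simp add: ring_ideal_add ring_ideal_mult)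
  then show "x + y \<in> saturation P I"
    using prime_ideal_compl_mult[OF assms(1) uv(1,3)] by (rule saturationI[rotated])
qed

text \<open>
  Nakayama's lemma over the localisation at \<open>P\<close>: \<open>N = L + x N\<close> with \<open>x \<in> P\<close> forces \<open>N = L\<close>.  A
  generator \<open>a\<close> of \<open>N\<close> can be eliminated because its coefficient \<open>u - x t\<close> is a unit there, that
  is, does not lie in \<open>P\<close>; induction on the number of generators finishes.
\<close>

lemma nakayama_saturation:
  fixes P :: "'a::comm_ring_1 set"
  assumes noeth: "noetherian TYPE('a)" and P: "prime_ideal P" and x: "x \<in> P"
    and L: "ring_ideal L" and N: "ring_ideal N"
    and NL: "\<And>a. a \<in> N \<Longrightarrow> \<exists>u l n. u \<notin> P \<and> l \<in> L \<and> n \<in> N \<and> u * a = l + x * n"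
  shows "N \<subseteq> saturation P L"
proof -
  have *: "X \<subseteq> saturation P L"
    if "finite X" "\<forall>a\<in>X. \<exists>u l n. u \<notin> P \<and> l \<in> L \<and> n \<in> ideal_gen X \<and> u * a = l + x * n" for X
    using that
  proof (induction X)
    case (insert a X)
    from insert.prems obtain u l n where a: "u \<notin> P" "l \<in> L" "n \<in> ideal_gen (insert a X)" "u * a = l + x * n"
      by auto
    then obtain t where t: "n - t * a \<in> ideal_gen X" by (auto simp: in_ideal_gen_insert)
    define w where "w = u - x * t"
    have w: "w \<notin> P"
    proof
      assume "w \<in> P"
      then have "w + x * t \<in> P"
        using x P by (intro ring_ideal_add ring_ideal_mult_right) (auto simp: prime_ideal_ideal)
      then show False using a(1) by (simp add: w_def)
    qed
    have wa: "w * a = l + x * (n - t * a)" using a(4) by (simp add: w_def algebra_simps)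
    have "\<exists>u l n. u \<notin> P \<and> l \<in> L \<and> n \<in> ideal_gen X \<and> u * b = l + x * n" if b: "b \<in> X" for b
    proof -
      from b insert.prems obtain u' l' n' where b: "u' \<notin> P" "l' \<in> L" "n' \<in> ideal_gen (insert a X)"
        "u' * b = l' + x * n'" by auto
      then obtain t' where t': "n' - t' * a \<in> ideal_gen X" by (auto simp: in_ideal_gen_insert)
      have "w * u' * b = w * l' + x * (w * (n' - t' * a)) + x * t' * (w * a)"
        unfolding mult.assoc b(4) by (simp add: algebra_simps)
      also have "\<dots> = (w * l' + x * t' * l) + x * (w * (n' - t' * a) + x * t' * (n - t * a))"
        unfolding wa by (simp add: algebra_simps)
      finally have "w * u' * b = (w * l' + x * t' * l) + x * (w * (n' - t' * a) + x * t' * (n - t * a))" .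
      moreover have "w * l' + x * t' * l \<in> L"
        using a(2) b(2) L by (simp add: ring_ideal_add ring_ideal_mult)
      moreover have "w * (n' - t' * a) + x * t' * (n - t * a) \<in> ideal_gen X"
        using t t' ring_ideal_ideal_gen[of X] by (simp add: ring_ideal_add ring_ideal_mult)
      ultimately show ?thesis using prime_ideal_compl_mult[OF P w b(1)] by blast
    qed
    then have X: "X \<subseteq> saturation P L" by (intro insert.IH) blast
    then have "ideal_gen X \<subseteq> saturation P L"
      by (rule ideal_gen_minimal) (rule ring_ideal_saturation[OF P L])
    then have "w * a \<in> saturation P L"
      using t a(2) saturation_superset[OF P, of L] ring_ideal_saturation[OF P L]
      unfolding wa by (intro ring_ideal_add ring_ideal_mult) auto
    then have "a \<in> saturation P (saturation P L)" using w by (rule saturationI[rotated])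
    then show ?case using X saturation_idem[OF P] by auto
  qed simp
  obtain X where X: "finite X" "ideal_gen X = N" using noeth N unfolding noetherian_def by blast
  then have "X \<subseteq> saturation P L"
    using NL ideal_gen_base by (intro *) blast+
  then show ?thesis using X(2) ideal_gen_minimal ring_ideal_saturation[OF P L] by blast
qed

text \<open>
  The descending chain condition for the quotient by \<open>I\<close> of the localisation at \<open>P\<close>: that quotient
  is artinian.
\<close>

definition saturated_dcc :: "'a::comm_ring_1 set \<Rightarrow> 'a set \<Rightarrow> bool" where
  "saturated_dcc P I \<longleftrightarrow> (\<forall>K. (\<forall>n. ring_ideal (K n) \<and> saturation P (K n) = K n \<and> I \<subseteq> K n \<and> K (Suc n) \<subseteq> K n)
     \<longrightarrow> (\<exists>N. \<forall>n\<ge>N. K n = K N))"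

text \<open>
  If \<open>P\<close> kills \<open>a\<close> modulo \<open>I\<close>, then \<open>(I + (a)) / I\<close> is zero or simple over the localisation, and
  an extension of an artinian module by a simple one is artinian: a chain is controlled by its sums
  and by its intersections with the larger ideal.
\<close>

lemma saturated_dcc_extend:
  assumes P: "prime_ideal P" and I: "ring_ideal I" "saturation P I = I"
    and a: "\<And>p. p \<in> P \<Longrightarrow> p * a \<in> I"
    and dcc: "saturated_dcc P (saturation P (ideal_gen (insert a I)))"
  shows "saturated_dcc P I"
  unfolding saturated_dcc_def
proof (intro allI impI)
  fix K :: "nat \<Rightarrow> 'a set"
  assume K: "\<forall>n. ring_ideal (K n) \<and> saturation P (K n) = K n \<and> I \<subseteq> K n \<and> K (Suc n) \<subseteq> K n"
  then have anti: "K n \<subseteq> K m" if "m \<le> n" for m n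
    using lift_Suc_antimono_le[of K m n] that by blast
  define J where "J = saturation P (ideal_gen (insert a I))"
  define K' where "K' n = saturation P (ideal_gen (K n \<union> J))" for n
  have J: "ring_ideal J" unfolding J_def
    by (intro ring_ideal_saturation ring_ideal_ideal_gen P)
  \<comment> \<open>\<open>J / I\<close> is simple or zero after localisation, so \<open>K n\<close> meets \<open>J\<close> either in \<open>I\<close> or in \<open>J\<close>\<close>
  have simple: "J \<subseteq> K n" if n: "k \<in> K n" "k \<in> J" "k \<notin> I" for k n
  proof -
    obtain u where u: "u \<notin> P" "u * k \<in> ideal_gen (insert a I)" using n(2) unfolding J_def by (rule saturationE)
    then obtain s where s: "u * k - s * a \<in> I" using in_ideal_gen_insert_ideal[OF I(1)] by blast
    have "s \<notin> P"
    proof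
      assume "s \<in> P"
      then have "u * k - s * a + s * a \<in> I" using a s I(1) ring_ideal_add by blast
      then have "k \<in> saturation P I" using u(1) by (auto intro: saturationI)
      then show False using n(3) I(2) by simp
    qed
    moreover have "u * k - (u * k - s * a) \<in> K n"
      by (rule ring_ideal_diff) (use K n(1) s in \<open>auto intro: ring_ideal_mult\<close>)
    ultimately have "a \<in> saturation P (K n)" by (intro saturationI[of s]) auto
    then have "a \<in> K n" using K by auto
    then have "ideal_gen (insert a I) \<subseteq> K n" using K by (intro ideal_gen_minimal) auto
    then have "J \<subseteq> saturation P (K n)" unfolding J_def by (rule saturation_mono)
    then show ?thesis using K by auto
  qed
  have "J \<subseteq> K' n" for n
    unfolding K'_def using saturation_superset[OF P] ideal_gen_base by blast
  moreover have "K' (Suc n) \<subseteq> K' n" for n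
    unfolding K'_def using K by (intro saturation_mono ideal_gen_mono) auto
  moreover have "ring_ideal (K' n)" "saturation P (K' n) = K' n" for n
    unfolding K'_def by (auto intro: ring_ideal_saturation ring_ideal_ideal_gen P simp: saturation_idem[OF P])
  ultimately obtain N1 where N1: "\<forall>n\<ge>N1. K' n = K' N1"
    using dcc[unfolded saturated_dcc_def, folded J_def, rule_format, of K'] by blast
  obtain N2 where N2: "(\<forall>n. J \<subseteq> K n) \<or> (\<forall>n\<ge>N2. K n \<inter> J \<subseteq> I)"
  proof (cases "\<forall>n. J \<subseteq> K n")
    case True then show ?thesis using that by blast
  next
    case False
    then obtain N2 where N2: "\<not> J \<subseteq> K N2" by blast
    have "K n \<inter> J \<subseteq> I" if "n \<ge> N2" for n
      using simple[of _ n] anti[OF that] N2 by blast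
    then show ?thesis using that by blast
  qed
  define N where "N = max N1 N2"
  have "K n = K N" if n: "n \<ge> N" for n
  proof
    show "K n \<subseteq> K N" using anti n .
    show "K N \<subseteq> K n"
    proof
      fix k assume k: "k \<in> K N"
      have "n \<ge> N1" "N \<ge> N1" using n unfolding N_def by auto
      then have "K' N = K' n" using N1 by metis
      moreover have "k \<in> K' N"
        unfolding K'_def using k saturation_superset[OF P] ideal_gen_base by blast
      ultimately obtain u where u: "u \<notin> P" "u * k \<in> ideal_gen (K n \<union> J)"
        unfolding K'_def by (metis saturationE)
      then obtain k' j where kj: "k' \<in> K n" "j \<in> J" "u * k = k' + j"
        using in_ideal_gen_Un[of "K n" J "u * k"] K J by blast
      then have "j = u * k - k'" by simp
      moreover have "k' \<in> K N" using kj(1) anti[OF n] by blast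
      ultimately have "j \<in> K N"
        using k K by (auto intro!: ring_ideal_diff ring_ideal_mult)
      moreover have "n \<ge> N2" "N \<ge> N2" using n unfolding N_def by auto
      ultimately have "j \<in> K n" using N2 kj(2) K by blast
      then have "u * k \<in> K n" using kj K by (auto intro: ring_ideal_add)
      then have "k \<in> saturation P (K n)" using u(1) by (auto intro: saturationI)
      then show "k \<in> K n" using K by auto
    qed
  qed
  then show "\<exists>N. \<forall>n\<ge>N. K n = K N" by blast
qed

text \<open>
  If \<open>P\<close> is minimal over \<open>I0\<close>, then the localisation at \<open>P\<close> is artinian modulo \<open>I0\<close>.  Take an ideal
  \<open>M\<close> that is maximal among the counterexamples.  A maximal colon ideal \<open>(M : a)\<close> is prime, lies
  between \<open>I0\<close> and \<open>P\<close>, and hence equals \<open>P\<close>.  So \<open>M + (a)\<close> extends \<open>M\<close> by a simple module; it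
  satisfies the chain condition by the choice of \<open>M\<close>, and then so does \<open>M\<close>.
\<close>

lemma saturated_dcc_minimal_prime:
  fixes P :: "'a::comm_ring_1 set"
  assumes noeth: "noetherian TYPE('a)" and P: "prime_ideal P"
    and minimal: "\<And>P'. prime_ideal P' \<Longrightarrow> I0 \<subseteq> P' \<Longrightarrow> P' \<subseteq> P \<Longrightarrow> P' = P"
    and I: "ring_ideal I" "saturation P I = I" "I0 \<subseteq> I"
  shows "saturated_dcc P I"
proof (rule ccontr)
  define F where "F = {I. ring_ideal I \<and> saturation P I = I \<and> I0 \<subseteq> I \<and> \<not> saturated_dcc P I}"
  assume "\<not> saturated_dcc P I"
  then have "F \<noteq> {}" using I by (auto simp: F_def)
  then obtain M where "M \<in> F" and M_max: "\<And>I. I \<in> F \<Longrightarrow> M \<subseteq> I \<Longrightarrow> I = M"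
    by (rule noetherian_maximal_member[OF noeth, of F]) (auto simp: F_def)
  then have M: "ring_ideal M" "saturation P M = M" "I0 \<subseteq> M" "\<not> saturated_dcc P M"
    by (auto simp: F_def)
  have "saturated_dcc P UNIV" unfolding saturated_dcc_def by (simp add: top.extremum_unique)
  then have "1 \<notin> M" using M ring_ideal_eq_UNIV by auto
  define C where "C = (\<lambda>a. {s. s * a \<in> M}) ` (- M)"
  have colon_ideal: "ring_ideal {s. s * a \<in> M}" for a
    unfolding ring_ideal_iff using M(1) by (auto simp: ring_ideal_iff distrib_right mult.assoc)
  have "C \<noteq> {}" using \<open>1 \<notin> M\<close> by (auto simp: C_def)
  then obtain D where D: "D \<in> C" "\<And>I. I \<in> C \<Longrightarrow> D \<subseteq> I \<Longrightarrow> I = D"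
    using colon_ideal by (elim noetherian_maximal_member[OF noeth]) (auto simp: C_def)
  then obtain a where a: "a \<notin> M" "D = {s. s * a \<in> M}" by (auto simp: C_def)
  have "prime_ideal D"
    unfolding prime_ideal_def
  proof (intro conjI allI impI)
    show "ring_ideal D" unfolding a(2) by (rule colon_ideal)
    show "D \<noteq> UNIV" using a by (metis UNIV_I mem_Collect_eq mult_1)
    fix x y assume xy: "x * y \<in> D"
    show "x \<in> D \<or> y \<in> D"
    proof (rule disjCI)
      assume "y \<notin> D"
      then have "{s. s * (y * a) \<in> M} \<in> C" by (auto simp: C_def a)
      moreover have "D \<subseteq> {s. s * (y * a) \<in> M}"
        using ring_ideal_mult[OF M(1)] by (auto simp: a(2) mult.left_commute[of _ y])
      ultimately have "{s. s * (y * a) \<in> M} = D" using D(2) by blast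
      moreover have "x \<in> {s. s * (y * a) \<in> M}" using xy by (simp add: a(2) mult.assoc)
      ultimately show "x \<in> D" by blast
    qed
  qed
  moreover have "I0 \<subseteq> D"
    using M(1,3) ring_ideal_mult_right unfolding a(2) by blast
  moreover have "D \<subseteq> P"
    using a M(2) saturationI[of _ P a M] by blast
  ultimately have "D = P" by (rule minimal)
  define J where "J = saturation P (ideal_gen (insert a M))"
  have MJ: "M \<subseteq> J" "a \<in> J" unfolding J_def
    using saturation_superset[OF P] ideal_gen_base by blast+
  then have "J \<notin> F" using M_max[of J] a by blast
  moreover have "ring_ideal J" "saturation P J = J" unfolding J_def
    by (auto intro: ring_ideal_saturation ring_ideal_ideal_gen P simp: saturation_idem[OF P])
  ultimately have "saturated_dcc P J" using MJ M(3) by (auto simp: F_def)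
  then have "saturated_dcc P M"
    unfolding J_def using \<open>D = P\<close> a(2) by (intro saturated_dcc_extend[OF P M(1,2), of a]) auto
  then show False using M(4) by blast
qed

text \<open>
  Krull's principal ideal theorem, in the form in which it shortens chains: in the domain modulo
  \<open>A\<close>, the prime \<open>P\<close> has height at least two and so is not minimal over \<open>x\<close>.  Otherwise the
  localisation at \<open>P\<close> is artinian modulo \<open>A + (x)\<close>.  Choose \<open>y \<in> Q - A\<close>; then the ideals
  \<open>Y n + (x)\<close> stabilise, where \<open>Y n\<close> is \<open>A + (y\<^sup>n)\<close> saturated at \<open>Q\<close>.  As \<open>x \<notin> Q\<close>,
  Nakayama's lemma removes \<open>x\<close> and leaves \<open>Y n = Y (n + 1)\<close>.  So \<open>y\<^sup>n (s - t y) \<in> A\<close> for some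
  \<open>s \<notin> Q\<close>, which is impossible for the prime \<open>A\<close>.
\<close>

lemma krull_principal_ideal:
  fixes P :: "'a::comm_ring_1 set"
  assumes noeth: "noetherian TYPE('a)" and A: "prime_ideal A" and Q: "prime_ideal Q" and P: "prime_ideal P"
    and AQ: "A \<subset> Q" and QP: "Q \<subset> P" and x: "x \<in> P"
  obtains P' where "prime_ideal P'" "x \<in> P'" "A \<subset> P'" "P' \<subset> P"
proof (rule ccontr)
  assume "\<not> thesis"
  then have no: "\<And>P'. prime_ideal P' \<Longrightarrow> x \<in> P' \<Longrightarrow> A \<subset> P' \<Longrightarrow> \<not> P' \<subset> P" using that by blast
  then have xQ: "x \<notin> Q" using Q AQ QP by blast
  then have xA: "x \<notin> A" using AQ by blast
  have minimal: "P' = P" if "prime_ideal P'" "insert x A \<subseteq> P'" "P' \<subseteq> P" for P'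
    using no[of P'] that xA by blast
  obtain y where y: "y \<in> Q" "y \<notin> A" using AQ by blast
  note idl = prime_ideal_ideal[OF A] prime_ideal_ideal[OF Q] prime_ideal_ideal[OF P]
  define Y where "Y n = saturation Q (ideal_gen (insert (y ^ n) A))" for n
  define K where "K n = saturation P (ideal_gen (insert x (Y n)))" for n
  have Y_ideal: "ring_ideal (Y n)" for n
    unfolding Y_def by (intro ring_ideal_saturation ring_ideal_ideal_gen Q)
  have Y_sat: "saturation Q (Y n) = Y n" for n
    unfolding Y_def by (rule saturation_idem[OF Q])
  have Y_mem: "insert (y ^ n) A \<subseteq> Y n" for n
    unfolding Y_def using saturation_superset[OF Q] ideal_gen_base by blast
  have Y_anti: "Y (Suc n) \<subseteq> Y n" for n
  proof -
    have "y ^ Suc n \<in> ideal_gen (insert (y ^ n) A)"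
      using ring_ideal_mult[OF ring_ideal_ideal_gen, of "y ^ n" _ y] ideal_gen_base[of "y ^ n"] by simp
    then have "ideal_gen (insert (y ^ Suc n) A) \<subseteq> ideal_gen (insert (y ^ n) A)"
      by (intro ideal_gen_minimal ring_ideal_ideal_gen) (auto intro: ideal_gen_base)
    then show ?thesis unfolding Y_def by (rule saturation_mono)
  qed
  have K: "ring_ideal (K n) \<and> saturation P (K n) = K n \<and> K (Suc n) \<subseteq> K n" for n
  proof (intro conjI)
    show "K (Suc n) \<subseteq> K n"
      unfolding K_def using Y_anti[of n] by (intro saturation_mono ideal_gen_mono) auto
    show "ring_ideal (K n)" "saturation P (K n) = K n"
      unfolding K_def by (intro ring_ideal_saturation ring_ideal_ideal_gen P saturation_idem)+
  qed
  define I where "I = saturation P (ideal_gen (insert x A))"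
  have "saturated_dcc P I"
  proof (rule saturated_dcc_minimal_prime[OF noeth P, of "insert x A"])
    show "insert x A \<subseteq> I" unfolding I_def using saturation_superset[OF P] ideal_gen_base by blast
    show "ring_ideal I" "saturation P I = I"
      unfolding I_def by (intro ring_ideal_saturation ring_ideal_ideal_gen P saturation_idem)+
  qed (rule minimal)
  moreover have "I \<subseteq> K n" for n
    unfolding I_def K_def using Y_mem by (intro saturation_mono ideal_gen_mono) auto
  ultimately obtain n where n: "\<forall>m\<ge>n. K m = K n"
    using K unfolding saturated_dcc_def by presburger
  then have Kn: "K (Suc n) = K n" by (meson le_SucI order_refl)
  have "Y n \<subseteq> saturation P (Y (Suc n))"
  proof (rule nakayama_saturation[OF noeth P x Y_ideal Y_ideal])
    fix a assume a: "a \<in> Y n"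
    have "a \<in> K n" unfolding K_def using a saturation_superset[OF P] ideal_gen_base by blast
    then have "a \<in> K (Suc n)" using Kn by simp
    then obtain u where u: "u \<notin> P" "u * a \<in> ideal_gen (insert x (Y (Suc n)))"
      unfolding K_def by (rule saturationE)
    then obtain c where c: "u * a - c * x \<in> Y (Suc n)" using in_ideal_gen_insert_ideal[OF Y_ideal] by blast
    have "u * a - (u * a - c * x) \<in> Y n"
      by (rule ring_ideal_diff[OF Y_ideal]) (use a c Y_anti in \<open>auto intro: ring_ideal_mult Y_ideal\<close>)
    then have "x * c \<in> Y n" by (simp add: mult.commute)
    then have "c \<in> saturation Q (Y n)" using xQ by (rule saturationI[rotated])
    then have "c \<in> Y n" by (simp add: Y_sat)
    then show "\<exists>u l n'. u \<notin> P \<and> l \<in> Y (Suc n) \<and> n' \<in> Y n \<and> u * a = l + x * n'"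
      using u(1) c by (intro exI[of _ u] exI[of _ "u * a - c * x"] exI[of _ c]) (simp add: mult.commute)
  qed
  then have "y ^ n \<in> saturation P (Y (Suc n))" using Y_mem by blast
  moreover have "saturation P (Y (Suc n)) \<subseteq> saturation Q (Y (Suc n))"
    using QP by (auto simp: saturation_def)
  ultimately have "y ^ n \<in> Y (Suc n)" using Y_sat by auto
  then obtain s where s: "s \<notin> Q" "s * y ^ n \<in> ideal_gen (insert (y ^ Suc n) A)"
    unfolding Y_def by (rule saturationE)
  then obtain t where "s * y ^ n - t * y ^ Suc n \<in> A" using in_ideal_gen_insert_ideal[OF idl(1)] by blast
  then have "y ^ n * (s - t * y) \<in> A" by (simp add: algebra_simps)
  moreover have "y ^ n \<notin> A"
    by (induction n) (use prime_ideal_one[OF A] y prime_ideal_compl_mult[OF A] in auto)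
  ultimately have "s - t * y \<in> Q" using prime_idealD[OF A] AQ by blast
  then have "s - t * y + t * y \<in> Q" using y(1) idl by (intro ring_ideal_add ring_ideal_mult) auto
  then show False using s(1) by simp
qed

section \<open>Regular local rings\<close>

primrec prime_chain :: "nat \<Rightarrow> 'a::comm_ring_1 set \<Rightarrow> 'a set \<Rightarrow> bool" where
  "prime_chain 0 A C \<longleftrightarrow> prime_ideal A \<and> C = A"
| "prime_chain (Suc n) A C \<longleftrightarrow> (\<exists>B. prime_chain n A B \<and> prime_ideal C \<and> B \<subset> C)"

lemma prime_chainD:
  assumes "prime_chain n A C"
  shows "prime_ideal A" "prime_ideal C" "A \<subseteq> C" "n > 0 \<Longrightarrow> A \<subset> C"
proof -
  have "prime_ideal A \<and> prime_ideal C \<and> A \<subseteq> C \<and> (n > 0 \<longrightarrow> A \<subset> C)"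
    using assms
  proof (induction n arbitrary: C)
    case (Suc n)
    then obtain B where "prime_chain n A B" "prime_ideal C" "B \<subset> C" by auto
    then show ?case using Suc.IH[of B] by blast
  qed simp
  then show "prime_ideal A" "prime_ideal C" "A \<subseteq> C" "n > 0 \<Longrightarrow> A \<subset> C" by auto
qed

lemma prime_chain_prepend:
  "prime_chain n A C \<Longrightarrow> prime_ideal A' \<Longrightarrow> A' \<subset> A \<Longrightarrow> prime_chain (Suc n) A' C"
  by (induction n arbitrary: C) (simp, metis prime_chain.simps(2))

lemma prime_chain_raise_top:
  "prime_chain (Suc n) A C \<Longrightarrow> prime_ideal D \<Longrightarrow> C \<subseteq> D \<Longrightarrow> prime_chain (Suc n) A D"
  using psubset_subset_trans by fastforce

text \<open>
  Adding an element to the lower end costs at most one step of a chain: from the top downwards, the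
  principal ideal theorem replaces each member of the chain that does not contain \<open>x\<close> by one that
  does.  This says that \<open>dim R/(A + (x)) \<ge> dim R/A - 1\<close>.
\<close>

lemma prime_chain_absorb:
  fixes A :: "'a::comm_ring_1 set"
  assumes noeth: "noetherian TYPE('a)"
  shows "prime_chain (Suc n) A C \<Longrightarrow> x \<in> C \<Longrightarrow> \<exists>A'. prime_chain n A' C \<and> insert x A \<subseteq> A'"
proof (induction n arbitrary: C)
  case 0
  then show ?case by auto
next
  case (Suc n)
  then obtain B where B: "prime_chain (Suc n) A B" "prime_ideal C" "B \<subset> C" by auto
  then obtain B' where B': "prime_chain n A B'" "prime_ideal B" "B' \<subset> B" by auto
  obtain P where P: "prime_ideal P" "x \<in> P" "B' \<subset> P" "P \<subset> C"
    using krull_principal_ideal[OF noeth prime_chainD(2)[OF B'(1)] B'(2) B(2) B'(3) B(3) Suc.prems(2)] .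
  then have "prime_chain (Suc n) A P" using B'(1) by auto
  from Suc.IH[OF this P(2)] obtain A' where "prime_chain n A' P" "insert x A \<subseteq> A'" by blast
  then show ?case using P(4) B(2) by auto
qed

lemma local_ring_maximal: "local_ring \<mm> \<Longrightarrow> ring_ideal \<mm>" "local_ring \<mm> \<Longrightarrow> \<mm> \<noteq> UNIV"
  by (auto simp: local_ring_def maximal_ideal_def)

lemma proper_ideal_subset_maximal:
  fixes \<mm> :: "'a::comm_ring_1 set"
  assumes noeth: "noetherian TYPE('a)" and m: "local_ring \<mm>" and I: "ring_ideal I" "I \<noteq> UNIV"
  shows "I \<subseteq> \<mm>"
proof -
  define F where "F = {J. ring_ideal J \<and> J \<noteq> UNIV \<and> I \<subseteq> J}"
  have "F \<noteq> {}" using I by (auto simp: F_def)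
  then obtain M where M: "M \<in> F" "\<And>J. J \<in> F \<Longrightarrow> M \<subseteq> J \<Longrightarrow> J = M"
    by (rule noetherian_maximal_member[OF noeth, of F]) (auto simp: F_def)
  then have "maximal_ideal M" unfolding maximal_ideal_def F_def by blast
  then have "M = \<mm>" using m by (auto simp: local_ring_def)
  then show ?thesis using M(1) by (auto simp: F_def)
qed

lemma local_ring_unit:
  fixes \<mm> :: "'a::comm_ring_1 set"
  assumes noeth: "noetherian TYPE('a)" and m: "local_ring \<mm>" and u: "u \<notin> \<mm>"
  obtains v where "v * u = 1"
proof -
  have "ideal_gen {u} = UNIV"
    using proper_ideal_subset_maximal[OF noeth m ring_ideal_ideal_gen[of "{u}"]] u ideal_gen_base[of u "{u}"]
    by blast
  then have "1 \<in> ideal_gen (insert u {})" by simp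
  then obtain v where "1 - v * u \<in> ideal_gen {}" by (auto simp: in_ideal_gen_insert)
  then have "v * u = 1"
    by (simp add: ideal_gen_def Modules.module.span_empty[OF module_mult_self])
  then show ?thesis by (rule that)
qed

lemma local_ring_prime:
  fixes \<mm> :: "'a::comm_ring_1 set"
  assumes noeth: "noetherian TYPE('a)" and m: "local_ring \<mm>"
  shows "prime_ideal \<mm>"
  unfolding prime_ideal_def
proof (intro conjI allI impI)
  fix x y assume xy: "x * y \<in> \<mm>"
  show "x \<in> \<mm> \<or> y \<in> \<mm>"
  proof (rule disjCI)
    assume "y \<notin> \<mm>"
    then obtain v where "v * y = 1" by (rule local_ring_unit[OF noeth m])
    then have "x = v * (x * y)" by (simp add: mult.left_commute[of v])
    then show "x \<in> \<mm>" using ring_ideal_mult[OF local_ring_maximal(1)[OF m] xy, of v] by simp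
  qed
qed (use m local_ring_maximal in auto)

lemma saturation_local_ring:
  fixes \<mm> :: "'a::comm_ring_1 set"
  assumes noeth: "noetherian TYPE('a)" and m: "local_ring \<mm>" and I: "ring_ideal I"
  shows "saturation \<mm> I = I"
proof
  show "saturation \<mm> I \<subseteq> I"
  proof
    fix a assume "a \<in> saturation \<mm> I"
    then obtain u where u: "u \<notin> \<mm>" "u * a \<in> I" by (rule saturationE)
    obtain v where "v * u = 1" using u(1) by (rule local_ring_unit[OF noeth m])
    then have "a = v * (u * a)" by (simp flip: mult.assoc)
    then show "a \<in> I" using ring_ideal_mult[OF I u(2), of v] by simp
  qed
qed (rule saturation_superset[OF local_ring_prime[OF noeth m]])

text \<open>
  Krull's height theorem for \<open>\<mm>\<close> modulo \<open>I\<close>: if \<open>\<mm> / I\<close> has \<open>n\<close> generators, absorb them one after the other;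
  a chain longer than \<open>n\<close> would keep a step above \<open>\<mm>\<close>.
\<close>

lemma prime_chain_length_le:
  fixes \<mm> :: "'a::comm_ring_1 set"
  assumes noeth: "noetherian TYPE('a)" and m: "local_ring \<mm>"
  shows "ideal_gen (I \<union> set xs) = \<mm> \<Longrightarrow> I \<subseteq> A \<Longrightarrow> prime_chain n A C \<Longrightarrow> n \<le> length xs"
proof (induction xs arbitrary: I A C n)
  case Nil
  have "\<mm> \<subseteq> A" using Nil prime_ideal_ideal[OF prime_chainD(1)[OF Nil(3)]] ideal_gen_minimal[of I A] by auto
  moreover have "C \<subseteq> \<mm>"
    using prime_chainD(2)[OF Nil(3)] proper_ideal_subset_maximal[OF noeth m, of C]
    by (auto simp: prime_ideal_def)
  ultimately show ?case using prime_chainD(4)[OF Nil(3)] by auto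
next
  case (Cons x xs)
  have C: "C \<subseteq> \<mm>"
    using prime_chainD(2)[OF Cons.prems(3)] proper_ideal_subset_maximal[OF noeth m, of C]
    by (auto simp: prime_ideal_def)
  show ?case
  proof (cases n)
    case (Suc k)
    have "prime_chain (Suc k) A \<mm>"
      using prime_chain_raise_top[OF _ local_ring_prime[OF noeth m] C] Cons.prems(3) Suc by blast
    moreover have "x \<in> \<mm>" using ideal_gen_base[of x "I \<union> set (x # xs)"] Cons.prems(1) by simp
    ultimately obtain A' where "prime_chain k A' \<mm>" "insert x A \<subseteq> A'"
      using prime_chain_absorb[OF noeth] by blast
    then have "k \<le> length xs"
      using Cons.prems(1,2) by (intro Cons.IH[of "insert x I" A' k \<mm>]) auto
    then show ?thesis using Suc by simp
  qed simp
qed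

text \<open>
  A regular local ring is a domain, stated for the quotient by \<open>I\<close>: \<open>\<mm> / I\<close> has as many generators
  as a chain \<open>A \<subset> \<dots> \<subset> C\<close> above \<open>I\<close> has steps.  Some generator \<open>x\<close> lies outside the bottom
  member \<open>A\<close> of the chain.  By induction both \<open>I + (x)\<close> and \<open>A + (x)\<close> are prime, and they agree,
  since a proper inclusion would give a chain longer than the number of generators.  So every
  \<open>a \<in> A\<close> is \<open>i + k x\<close> with \<open>i \<in> I\<close>, where \<open>k \<in> A\<close> because \<open>A\<close> is prime.  Hence \<open>A = I + x A\<close>,
  and Nakayama's lemma gives \<open>I = A\<close>.
\<close>

lemma prime_ideal_if_few_generators:
  fixes \<mm> :: "'a::comm_ring_1 set"
  assumes noeth: "noetherian TYPE('a)" and m: "local_ring \<mm>"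
  shows "ring_ideal I \<Longrightarrow> ideal_gen (I \<union> set xs) = \<mm> \<Longrightarrow> I \<subseteq> A \<Longrightarrow> prime_chain (length xs) A C \<Longrightarrow> prime_ideal I"
proof (induction "length xs" arbitrary: I xs A C)
  case 0
  then have "\<mm> = I" "prime_ideal A" using prime_chainD(1) by (auto simp: ideal_gen_ideal)
  then show ?case using local_ring_prime[OF noeth m] by simp
next
  case (Suc n)
  note chain = Suc.prems(4)[folded Suc.hyps(2)]
  note m_prime = local_ring_prime[OF noeth m]
  have A: "prime_ideal A" by (rule prime_chainD(1)[OF chain])
  have "C \<subseteq> \<mm>"
    using prime_chainD(2)[OF chain] proper_ideal_subset_maximal[OF noeth m, of C]
    by (auto simp: prime_ideal_def)
  then have chain_m: "prime_chain (Suc n) A \<mm>"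
    using prime_chain_raise_top[OF chain m_prime] by blast
  then have Am: "A \<subset> \<mm>" using prime_chainD(4) by blast
  obtain x where x: "x \<in> set xs" "x \<notin> A"
  proof -
    have "\<not> set xs \<subseteq> A"
      using Am Suc.prems(2,3) ideal_gen_minimal[of "I \<union> set xs" A] prime_ideal_ideal[OF A] by auto
    then show ?thesis using that by blast
  qed
  define ys where "ys = remove1 x xs"
  have ys: "n = length ys" "insert x (set ys) = set xs"
    using Suc.hyps(2) x(1) set_remove1_subset[of x xs] unfolding ys_def
    by (auto simp: length_remove1) (metis in_set_remove1)
  have "x \<in> \<mm>" using x(1) Suc.prems(2) ideal_gen_base by blast
  then obtain A' where A': "prime_chain n A' \<mm>" "insert x A \<subseteq> A'"
    using prime_chain_absorb[OF noeth chain_m] by blast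
  note A'_ideal = prime_ideal_ideal[OF prime_chainD(1)[OF A'(1)]]
  define J where "J = ideal_gen (insert x I)"
  define K where "K = ideal_gen (insert x A)"
  have JK: "J \<subseteq> K" unfolding J_def K_def using Suc.prems(3) by (intro ideal_gen_mono) auto
  have KA': "K \<subseteq> A'" unfolding K_def by (rule ideal_gen_minimal[OF A'(2) A'_ideal])
  have J_gen: "ideal_gen (J \<union> set ys) = \<mm>"
    unfolding J_def ideal_gen_Un_gen using Suc.prems(2) ys(2) by (simp flip: Un_insert_right)
  have "ideal_gen (insert x A \<union> set ys) = \<mm>"
  proof
    have "set xs \<subseteq> \<mm>" using Suc.prems(2) ideal_gen_base by blast
    then show "ideal_gen (insert x A \<union> set ys) \<subseteq> \<mm>"
      using Am ys(2) by (intro ideal_gen_minimal local_ring_maximal m) auto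
    show "\<mm> \<subseteq> ideal_gen (insert x A \<union> set ys)"
      unfolding Suc.prems(2)[symmetric] using Suc.prems(3) ys(2) by (intro ideal_gen_mono) auto
  qed
  then have K_gen: "ideal_gen (K \<union> set ys) = \<mm>" unfolding K_def ideal_gen_Un_gen .
  have J: "prime_ideal J"
    by (rule Suc.hyps(1)[OF ys(1) _ J_gen _ A'(1)[unfolded ys(1)]]) (use JK KA' in \<open>auto simp: J_def ring_ideal_ideal_gen\<close>)
  have K: "prime_ideal K"
    by (rule Suc.hyps(1)[OF ys(1) _ K_gen KA' A'(1)[unfolded ys(1)]]) (simp add: K_def ring_ideal_ideal_gen)
  \<comment> \<open>a proper inclusion would give a chain of length \<open>Suc n\<close> above \<open>J\<close>, which \<open>n\<close> further generators do not allow\<close>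
  have "J = K"
  proof (rule ccontr)
    assume "J \<noteq> K"
    then have "prime_chain (Suc n) J \<mm>" using JK KA' by (intro prime_chain_prepend[OF A'(1) J]) auto
    then have "Suc n \<le> length ys" by (rule prime_chain_length_le[OF noeth m J_gen order_refl])
    then show False using ys(1) by simp
  qed
  have "A \<subseteq> saturation \<mm> I"
  proof (rule nakayama_saturation[OF noeth m_prime \<open>x \<in> \<mm>\<close> Suc.prems(1) prime_ideal_ideal[OF A]])
    fix a assume a: "a \<in> A"
    then have "a \<in> J" unfolding \<open>J = K\<close> K_def by (intro ideal_gen_base) auto
    then obtain k where k: "a - k * x \<in> I" unfolding J_def using in_ideal_gen_insert_ideal[OF Suc.prems(1)] by blast
    then have "a - (a - k * x) \<in> A"
      by (rule ring_ideal_diff[OF prime_ideal_ideal[OF A] a subsetD[OF Suc.prems(3)]])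
    then have "k \<in> A" using prime_idealD[OF A, of k x] x(2) by simp
    then show "\<exists>u l n. u \<notin> \<mm> \<and> l \<in> I \<and> n \<in> A \<and> u * a = l + x * n"
      using k prime_ideal_one[OF m_prime]
      by (intro exI[of _ 1] exI[of _ "a - k * x"] exI[of _ k]) (simp add: mult.commute)
  qed
  then have "I = A" using saturation_local_ring[OF noeth m Suc.prems(1)] Suc.prems(3) by blast
  then show ?case using A by simp
qed

text \<open>
  A minimal set of generators of \<open>\<mm>\<close>, in any order, is a regular sequence: the ideals generated by
  its initial segments are prime, and the next generator lies outside, as otherwise the quotient by
  the segment would have too few generators of its maximal ideal for its dimension.
\<close>

lemma regular_local_ring_regular_sequence:
  fixes \<mm> :: "'a::comm_ring_1 set"
  assumes reg: "regular_local_ring \<mm>" and dim: "krull_dim TYPE('a) = enat d"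
  obtains x where "regular_sequence x d" "ideal_gen (x ` {..<d}) = \<mm>"
proof -
  have noeth: "noetherian TYPE('a)" and m: "local_ring \<mm>" using reg by (auto simp: regular_local_ring_def)
  note m_prime = local_ring_prime[OF noeth m]
  obtain X where X: "finite X" "card X = d" "ideal_gen X = \<mm>"
    using reg dim by (auto simp: regular_local_ring_def)
  then obtain x where x: "bij_betw x {..<d} X"
    using ex_bij_betw_nat_finite[OF X(1)] by (auto simp: atLeast0LessThan)
  then have xX: "x ` {..<d} = X" by (rule bij_betw_imp_surj_on)
  have x_m: "x i \<in> \<mm>" if "i < d" for i
    using that xX ideal_gen_base[of "x i" X] unfolding X(3) by blast
  have split: "x ` {..<i} \<union> set (map x [i..<d]) = X" if "i \<le> d" for i
    using that xX by (simp flip: image_Un add: ivl_disj_un_one(2))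
  have "\<exists>A. prime_chain d A \<mm>"
  proof (cases d)
    case 0
    then show ?thesis using m_prime by auto
  next
    case (Suc k)
    obtain n and P :: "nat \<Rightarrow> 'a set" where P: "n \<ge> d" "\<forall>i\<le>n. prime_ideal (P i)" "\<forall>i<n. P i \<subset> P (Suc i)"
    proof (rule ccontr)
      assume "\<not> thesis"
      then have "krull_dim TYPE('a) \<le> enat k"
        unfolding krull_dim_def using that Suc by (intro Sup_least) (auto simp: not_le, metis less_Suc_eq_le not_le)
      then show False using dim Suc by simp
    qed
    have "prime_chain i (P 0) (P i)" if "i \<le> n" for i
      using that
    proof (induction i)
      case (Suc i)
      then have "prime_chain i (P 0) (P i)" "P i \<subset> P (Suc i)" "prime_ideal (P (Suc i))" using P by auto
      then show ?case by auto
    qed (use P in simp)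
    then have "prime_chain d (P 0) (P d)" using P(1) by blast
    moreover have "P d \<subseteq> \<mm>"
      using P(1,2) proper_ideal_subset_maximal[OF noeth m, of "P d"] by (auto simp: prime_ideal_def)
    ultimately show ?thesis using prime_chain_raise_top[OF _ m_prime] Suc by blast
  qed
  then have chains: "\<exists>A. prime_chain (d - i) A \<mm> \<and> x ` {..<i} \<subseteq> A" if "i \<le> d" for i
    using that
  proof (induction i)
    case (Suc i)
    then obtain A where A: "prime_chain (Suc (d - Suc i)) A \<mm>" "x ` {..<i} \<subseteq> A"
      by (metis Suc_diff_Suc Suc_leD Suc_le_lessD)
    then obtain A' where "prime_chain (d - Suc i) A' \<mm>" "insert (x i) A \<subseteq> A'"
      using prime_chain_absorb[OF noeth A(1) x_m[of i]] Suc.prems by auto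
    then show ?case using A(2) by (auto simp: lessThan_Suc)
  qed simp
  have prime: "prime_ideal (ideal_gen (x ` {..<i}))" if i: "i \<le> d" for i
  proof -
    obtain A where A: "prime_chain (d - i) A \<mm>" "x ` {..<i} \<subseteq> A" using chains[OF i] by blast
    show ?thesis
    proof (rule prime_ideal_if_few_generators[OF noeth m ring_ideal_ideal_gen])
      show "ideal_gen (ideal_gen (x ` {..<i}) \<union> set (map x [i..<d])) = \<mm>"
        unfolding ideal_gen_Un_gen split[OF i] X(3) ..
      show "ideal_gen (x ` {..<i}) \<subseteq> A"
        by (rule ideal_gen_minimal[OF A(2) prime_ideal_ideal[OF prime_chainD(1)[OF A(1)]]])
      show "prime_chain (length (map x [i..<d])) A \<mm>" using A(1) by simp
    qed
  qed
  have not_in: "x i \<notin> ideal_gen (x ` {..<i})" if i: "i < d" for i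
  proof
    assume xi: "x i \<in> ideal_gen (x ` {..<i})"
    obtain A where A: "prime_chain (d - i) A \<mm>" "x ` {..<i} \<subseteq> A" using chains[of i] i by auto
    define W where "W = x ` {..<i} \<union> set (map x [Suc i..<d])"
    have "x i \<in> ideal_gen W"
      using xi ideal_gen_mono[of "x ` {..<i}" W] by (auto simp: W_def)
    then have "ideal_gen (insert (x i) W) \<subseteq> ideal_gen W"
      by (intro ideal_gen_minimal ring_ideal_ideal_gen) (auto intro: ideal_gen_base)
    moreover have "insert (x i) W = X"
      using split[of i] i by (simp add: W_def upt_rec[of i])
    ultimately have "ideal_gen W = \<mm>"
      using X(3) ideal_gen_mono[of W X] by blast
    then have "d - i \<le> length (map x [Suc i..<d])"
      unfolding W_def by (rule prime_chain_length_le[OF noeth m _ A(2,1)])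
    then show False using i by simp
  qed
  have "regular_sequence x d"
    unfolding regular_sequence_def
  proof (intro conjI allI impI)
    fix i y assume i: "i < d" and "x i * y \<in> ideal_gen (x ` {..<i})"
    then show "y \<in> ideal_gen (x ` {..<i})"
      using prime_idealD[OF prime[of i], of "x i" y] not_in[OF i] by simp
  next
    show "ideal_gen (x ` {..<d}) \<noteq> UNIV"
      unfolding xX X(3) by (rule local_ring_maximal(2)[OF m])
  qed
  then show ?thesis by (rule that) (simp add: xX X(3))
qed

section \<open>The length of minimal free resolutions\<close>

locale graded_free_module = Modules.module sc
  for sc :: "'a::comm_ring_1 \<Rightarrow> 'g::ab_group_add \<Rightarrow> 'g" +
  fixes B :: "int \<Rightarrow> 'g set"
  assumes graded: "graded_free sc B" and spanning: "span (\<Union>j. B j) = UNIV"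
begin

abbreviation coord :: "'g \<Rightarrow> 'g \<Rightarrow> 'a" where
  "coord \<equiv> representation (\<Union>j. B j)"

lemma finite_basis: "finite (B j)"
  and basis_independent: "independent (\<Union>j. B j)"
  using graded by (auto simp: graded_free_def)

lemma coord_add: "coord (x + y) e = coord x e + coord y e"
  and coord_diff: "coord (x - y) e = coord x e - coord y e"
  and coord_uminus: "coord (- x) e = - coord x e"
  and coord_scale: "coord (sc s x) e = s * coord x e"
  and coord_zero: "coord 0 e = 0"
  and coord_sum: "coord (sum g A) e = (\<Sum>a\<in>A. coord (g a) e)"
  using basis_independent spanning
  by (simp_all add: representation_add representation_diff representation_neg representation_scale representation_zero
      representation_sum)

lemma coord_basis: "b \<in> B j \<Longrightarrow> coord b e = (if e = b then 1 else 0)"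
  using representation_basis[OF basis_independent UN_I[of j UNIV b B]] by simp

lemma coord_piece: "x \<in> span (B j) \<Longrightarrow> coord x e \<noteq> 0 \<Longrightarrow> e \<in> B j"
proof -
  assume x: "x \<in> span (B j)" and e: "coord x e \<noteq> 0"
  have "coord x = representation (B j) x"
    by (rule representation_extend[OF basis_independent x]) auto
  then show "e \<in> B j" using e representation_ne_zero[of "B j" x e] by simp
qed

lemma coord_expansion: "x = (\<Sum>e | coord x e \<noteq> 0. sc (coord x e) e)"
  using sum_nonzero_representation_eq[OF basis_independent, of x] spanning by simp

lemma coord_combination:
  "coord (\<Sum>b\<in>B j. sc (k b) b) e = (if e \<in> B j then k e else 0)"
proof -
  have "coord (\<Sum>b\<in>B j. sc (k b) b) e = (\<Sum>b\<in>B j. if e = b then k b else 0)"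
    unfolding coord_sum by (rule sum.cong) (auto simp: coord_scale coord_basis)
  then show ?thesis using finite_basis by simp
qed

lemma subspace_coord: "ring_ideal I \<Longrightarrow> subspace {x. \<forall>e. coord x e \<in> I}"
  by (auto simp: subspace_def coord_add coord_scale coord_zero ring_ideal_0 ring_ideal_add ring_ideal_mult)

lemma coord_hom_in_ideal:
  assumes d: "module_hom sc sc d" and I: "ring_ideal I" and x: "\<And>e. coord x e \<in> I"
  shows "coord (d x) e \<in> I"
proof -
  interpret d: module_hom sc sc d by (rule d)
  have "d x = (\<Sum>b | coord x b \<noteq> 0. sc (coord x b) (d b))"
    using arg_cong[OF coord_expansion[of x], of d] by (simp add: d.sum d.scale)
  then have "coord (d x) e = (\<Sum>b | coord x b \<noteq> 0. coord x b * coord (d b) e)"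
    by (simp add: coord_sum coord_scale)
  then show ?thesis using x I by (auto intro!: ring_ideal_sum ring_ideal_mult_right)
qed

text \<open>
  Reducing modulo the first \<open>t\<close> members of a regular sequence a complex of free modules that is exact
  in positive degrees keeps it exact in degrees above \<open>t\<close>.  This is the long exact homology sequence
  of multiplication by \<open>x t\<close>, which is injective on the complex reduced modulo the members before
  it; here the connecting homomorphism is followed on elements.
\<close>

lemma exact_modulo_regular_sequence:
  fixes x :: "nat \<Rightarrow> 'a"
  assumes d: "module_hom sc sc d"
    and degree: "\<And>j. d ` span (B j) \<subseteq> span (B (j - 1))"
    and exact: "\<And>j. j \<ge> 1 \<Longrightarrow> {z \<in> span (B j). d z = 0} = d ` span (B (j + 1))"
    and regular: "regular_sequence x n"
  shows "t \<le> n \<Longrightarrow> int t < i \<Longrightarrow> z \<in> span (B i) \<Longrightarrow> (\<And>e. coord (d z) e \<in> ideal_gen (x ` {..<t})) \<Longrightarrow>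
    \<exists>v \<in> span (B (i + 1)). \<forall>e. coord (z - d v) e \<in> ideal_gen (x ` {..<t})"
proof (induction t arbitrary: i z)
  interpret d: module_hom sc sc d by (rule d)
  case 0
  then have "coord (d z) e = 0" for e
    by (simp add: ideal_gen_def Modules.module.span_empty[OF module_mult_self])
  then have "d z = 0" using coord_expansion[of "d z"] by simp
  then have "z \<in> d ` span (B (i + 1))" using exact[of i] 0 by auto
  then obtain v where "v \<in> span (B (i + 1))" "z = d v" by blast
  then show ?case by (intro bexI[of _ v]) (auto simp: coord_zero intro: ring_ideal_0 ring_ideal_ideal_gen)
next
  interpret d: module_hom sc sc d by (rule d)
  case (Suc t)
  define I where "I = ideal_gen (x ` {..<t})"
  have I: "ring_ideal I" unfolding I_def by (rule ring_ideal_ideal_gen)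
  have I_Suc: "y \<in> ideal_gen (x ` {..<Suc t}) \<longleftrightarrow> (\<exists>k. y - k * x t \<in> I)" for y
    by (simp add: lessThan_Suc in_ideal_gen_insert I_def)
  have x_regular: "y \<in> I" if "x t * y \<in> I" for y
    using that regular Suc.prems(1) unfolding regular_sequence_def I_def by auto
  have dz: "d z \<in> span (B (i - 1))" using degree Suc.prems(3) by blast
  have ddz: "d (d z) = 0"
    using exact[of "i - 1"] Suc.prems(2,3) by auto
  obtain k where k: "coord (d z) e - k e * x t \<in> I" for e
    using Suc.prems(4) unfolding I_Suc by metis
  \<comment> \<open>\<open>w\<close> represents the image of \<open>z\<close> under the connecting homomorphism\<close>
  define w where "w = (\<Sum>b\<in>B (i - 1). sc (k b) b)"
  have w: "w \<in> span (B (i - 1))" unfolding w_def by (intro span_sum span_scale span_base)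
  have dz_w: "coord (d z - sc (x t) w) e \<in> I" for e
    using k[of e] coord_piece[OF dz, of e] ring_ideal_0[OF I]
    by (cases "coord (d z) e = 0"; cases "e \<in> B (i - 1)")
      (auto simp: coord_diff coord_scale w_def coord_combination mult.commute)
  have "coord (d w) e \<in> I" for e
  proof (rule x_regular)
    have "coord (d (d z - sc (x t) w)) e \<in> I" by (rule coord_hom_in_ideal[OF d I dz_w])
    then have "- (x t * coord (d w) e) \<in> I" by (simp add: d.diff d.scale ddz coord_uminus coord_scale)
    then show "x t * coord (d w) e \<in> I" using ring_ideal_uminus[OF I] by fastforce
  qed
  then obtain v where v: "v \<in> span (B i)" "\<And>e. coord (w - d v) e \<in> I"
    using Suc.IH[of "i - 1" w] Suc.prems(1,2) w unfolding I_def by auto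
  define z' where "z' = z - sc (x t) v"
  have "coord (d z') e \<in> I" for e
  proof -
    have "d z' = (d z - sc (x t) w) + sc (x t) (w - d v)"
      by (simp add: z'_def d.diff d.scale scale_right_diff_distrib)
    then have "coord (d z') e = coord (d z - sc (x t) w) e + x t * coord (w - d v) e"
      by (simp only: coord_add coord_scale)
    then show ?thesis using dz_w v(2) I by (simp add: ring_ideal_add ring_ideal_mult)
  qed
  moreover have "z' \<in> span (B i)" unfolding z'_def using Suc.prems(3) v(1) by (intro span_diff span_scale)
  ultimately obtain v' where v': "v' \<in> span (B (i + 1))" "\<And>e. coord (z' - d v') e \<in> I"
    using Suc.IH[of i z'] Suc.prems(1,2) unfolding I_def by auto
  have "coord (z - d v') e \<in> ideal_gen (x ` {..<Suc t})" for e
    unfolding I_Suc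
  proof
    show "coord (z - d v') e - coord v e * x t \<in> I"
      using v'(2)[of e] by (simp add: z'_def coord_diff coord_add coord_scale algebra_simps)
  qed
  then show ?case using v'(1) by blast
qed

text \<open>
  Modulo the whole sequence the differential of a minimal complex is zero, and in degrees above \<open>n\<close>
  the reduced complex is exact; so its terms vanish there.
\<close>

lemma minimal_complex_vanishes:
  fixes x :: "nat \<Rightarrow> 'a"
  assumes d: "module_hom sc sc d"
    and degree: "\<And>j. d ` span (B j) \<subseteq> span (B (j - 1))"
    and exact: "\<And>j. j \<ge> 1 \<Longrightarrow> {z \<in> span (B j). d z = 0} = d ` span (B (j + 1))"
    and regular: "regular_sequence x n"
    and minimal: "range d \<subseteq> span {sc s z | s z. s \<in> ideal_gen (x ` {..<n})}"
    and i: "i > int n"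
  shows "B i = {}"
proof (rule ccontr)
  define \<mm> where "\<mm> = ideal_gen (x ` {..<n})"
  have m: "ring_ideal \<mm>" unfolding \<mm>_def by (rule ring_ideal_ideal_gen)
  have "span {sc s z | s z. s \<in> \<mm>} \<subseteq> {z. \<forall>e. coord z e \<in> \<mm>}"
    by (intro span_minimal subspace_coord m) (auto simp: coord_scale intro: ring_ideal_mult_right[OF m])
  then have d_m: "coord (d z) e \<in> \<mm>" for z e using minimal unfolding \<mm>_def by blast
  assume "B i \<noteq> {}"
  then obtain e where e: "e \<in> B i" by blast
  obtain v where "\<And>e'. coord (e - d v) e' \<in> \<mm>"
    using exact_modulo_regular_sequence[OF d degree exact regular order_refl i span_base[OF e]] d_m
    unfolding \<mm>_def by blast
  then have "coord (e - d v) e + coord (d v) e \<in> \<mm>" using d_m by (intro ring_ideal_add[OF m])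
  then have "1 \<in> \<mm>" using coord_basis[OF e, of e] by (simp add: coord_diff)
  then have "\<mm> = UNIV" using ring_ideal_eq_UNIV[OF m] by blast
  then show False using regular by (simp add: regular_sequence_def \<mm>_def)
qed

end

text \<open>
  Hilbert's syzygy theorem over a regular local ring.
\<close>

lemma minimal_free_resolution_length_le_dim:
  fixes \<mm> :: "'s::comm_ring_1 set"
  assumes "regular_local_ring \<mm>" and "krull_dim TYPE('s) = enat d"
    and res: "minimal_free_resolution \<mm> sc B dG scM \<epsilon>" and "i > int d"
  shows "B i = {}"
proof -
  obtain x where x: "regular_sequence x d" "ideal_gen (x ` {..<d}) = \<mm>"
    using regular_local_ring_regular_sequence[OF assms(1,2)] .
  have *: "Modules.module sc"
    using res by (auto simp: minimal_free_resolution_def graded_free_def)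
  interpret Modules.module sc by (rule *)
  interpret graded_free_module sc B
    using res by unfold_locales (auto simp: minimal_free_resolution_def)
  show ?thesis
    by (rule minimal_complex_vanishes[of dG x d i])
      (use res x assms(4) in \<open>auto simp: minimal_free_resolution_def\<close>)
qed

section \<open>Minors of Toeplitz matrices indexed by multi-indices\<close>

lemma mdeg_eq_sum:
  "finite S \<Longrightarrow> Poly_Mapping.keys a \<subseteq> S \<Longrightarrow> mdeg a = (\<Sum>i\<in>S. Poly_Mapping.lookup a i)"
  unfolding mdeg_def by (rule sum.mono_neutral_left) (auto simp: in_keys_iff)

lemma mdeg_add: "mdeg (a + b) = mdeg a + mdeg b"
proof -
  let ?S = "Poly_Mapping.keys a \<union> Poly_Mapping.keys b"
  have "mdeg (a + b) = (\<Sum>i\<in>?S. Poly_Mapping.lookup (a + b) i)"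
    by (intro mdeg_eq_sum) (auto simp: in_keys_iff lookup_add)
  also have "\<dots> = (\<Sum>i\<in>?S. Poly_Mapping.lookup a i) + (\<Sum>i\<in>?S. Poly_Mapping.lookup b i)"
    by (simp add: lookup_add sum.distrib)
  also have "\<dots> = mdeg a + mdeg b" by (subst (1 2) mdeg_eq_sum[of ?S]) auto
  finally show ?thesis .
qed

lemma mdeg_single: "mdeg (Poly_Mapping.single i n) = n"
  by (subst mdeg_eq_sum[of "{i}"]) (auto simp: lookup_single)

lemma multi_index_decompose:
  fixes a b :: multi_index
  assumes "\<And>i. Poly_Mapping.lookup a i \<le> Poly_Mapping.lookup b i"
  shows "b = (b - a) + a"
  using assms by (intro poly_mapping_eqI) (simp add: lookup_add lookup_minus)

lemma mdeg_mono:
  assumes "\<And>i. Poly_Mapping.lookup a i \<le> Poly_Mapping.lookup b i"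
  shows "mdeg a \<le> mdeg b"
  using mdeg_add[of "b - a" a] multi_index_decompose[OF assms] by simp

lemma lookup_le_mdeg: "Poly_Mapping.lookup a i \<le> mdeg a"
  using mdeg_mono[of "Poly_Mapping.single i (Poly_Mapping.lookup a i)" a]
  by (simp add: mdeg_single lookup_single when_def)

lemma multi_indices_iff: "a \<in> multi_indices c \<longleftrightarrow> (\<forall>i\<ge>c. Poly_Mapping.lookup a i = 0)"
  unfolding multi_indices_def by (auto simp: in_keys_iff subset_iff not_le)

lemma det_mat:
  fixes F :: "nat \<Rightarrow> nat \<Rightarrow> 'r::comm_ring_1"
  shows "det (mat r r (\<lambda>(i, j). F i j)) = (\<Sum>p | p permutes {0..<r}. signof p * (\<Prod>i=0..<r. F i (p i)))"
proof -
  have "(\<Prod>i=0..<r. mat r r (\<lambda>(i, j). F i j) $$ (i, p i)) = (\<Prod>i=0..<r. F i (p i))"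
    if "p permutes {0..<r}" for p
    using permutes_in_image[OF that] by (intro prod.cong) auto
  then show ?thesis unfolding det_def by (auto intro!: sum.cong)
qed

text \<open>
  A block diagonal matrix may be changed above its diagonal blocks without changing the determinant.
  The blocks are given by labels of rows and columns.  A permutation that contributes to the
  determinant of \<open>A'\<close> never decreases the label; as rows and columns have the same sum of labels, it
  preserves every label, and so it only sees entries that \<open>A\<close> and \<open>A'\<close> have in common.  The
  permutation \<open>s\<close> expresses that all blocks are square.
\<close>

lemma det_eq_block_triangular:
  fixes A A' :: "nat \<Rightarrow> nat \<Rightarrow> 'r::comm_ring_1" and \<rho> \<kappa> :: "nat \<Rightarrow> nat"
  assumes s: "s permutes {0..<r}" "\<And>i. i < r \<Longrightarrow> \<rho> i = \<kappa> (s i)"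
    and supp: "\<And>i j. i < r \<Longrightarrow> j < r \<Longrightarrow> A i j \<noteq> 0 \<Longrightarrow> \<rho> i = \<kappa> j"
    and same: "\<And>i j. i < r \<Longrightarrow> j < r \<Longrightarrow> \<rho> i = \<kappa> j \<Longrightarrow> A' i j = A i j"
    and below: "\<And>i j. i < r \<Longrightarrow> j < r \<Longrightarrow> \<kappa> j < \<rho> i \<Longrightarrow> A' i j = 0"
  shows "det (mat r r (\<lambda>(i, j). A' i j)) = det (mat r r (\<lambda>(i, j). A i j))"
proof -
  have "(\<Prod>i=0..<r. A' i (p i)) = (\<Prod>i=0..<r. A i (p i))" if p: "p permutes {0..<r}" for p
  proof (cases "\<forall>i<r. \<rho> i = \<kappa> (p i)")
    case True
    then show ?thesis using permutes_in_image[OF p] by (intro prod.cong) (auto intro!: same)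
  next
    case False
    then obtain i where i: "i < r" "\<rho> i \<noteq> \<kappa> (p i)" by blast
    have p_less: "p k < r" if "k < r" for k using permutes_in_image[OF p, of k] that by simp
    have "A i (p i) = 0" using supp[of i "p i"] i p_less by blast
    then have "(\<Prod>i=0..<r. A i (p i)) = 0" using i(1) by (intro prod_zero) auto
    moreover have "\<exists>k<r. \<kappa> (p k) < \<rho> k"
    proof (rule ccontr)
      assume "\<not> (\<exists>k<r. \<kappa> (p k) < \<rho> k)"
      then have le: "\<rho> k \<le> \<kappa> (p k)" if "k < r" for k using that by (meson not_le)
      then have "\<rho> i < \<kappa> (p i)" using i by (simp add: order_less_le)
      then have "(\<Sum>k=0..<r. \<rho> k) < (\<Sum>k=0..<r. \<kappa> (p k))"
        using i(1) le by (intro sum_strict_mono_ex1) auto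
      also have "\<dots> = (\<Sum>k=0..<r. \<kappa> k)" using sum.permute[OF p, of \<kappa>] by (simp add: comp_def)
      also have "\<dots> = (\<Sum>k=0..<r. \<kappa> (s k))" using sum.permute[OF s(1), of \<kappa>] by (simp add: comp_def)
      also have "\<dots> = (\<Sum>k=0..<r. \<rho> k)" using s(2) by simp
      finally show False by simp
    qed
    then obtain k where k: "k < r" "\<kappa> (p k) < \<rho> k" by blast
    then have "A' k (p k) = 0" using below p_less by blast
    then have "(\<Prod>i=0..<r. A' i (p i)) = 0" using k(1) by (intro prod_zero) auto
    ultimately show ?thesis by simp
  qed
  then show ?thesis unfolding det_mat by (intro sum.cong) auto
qed

lemma det_nonzero_permutation:
  fixes A :: "nat \<Rightarrow> nat \<Rightarrow> 'r::comm_ring_1"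
  assumes "det (mat r r (\<lambda>(i, j). A i j)) \<noteq> 0"
  obtains s where "s permutes {0..<r}" "\<And>i. i < r \<Longrightarrow> A i (s i) \<noteq> 0"
proof -
  obtain s where s: "s permutes {0..<r}" "signof s * (\<Prod>i=0..<r. A i (s i)) \<noteq> 0"
    using assms sum.not_neutral_contains_not_neutral unfolding det_mat by blast
  have "A i (s i) \<noteq> 0" if "i < r" for i
  proof
    assume "A i (s i) = 0"
    then have "(\<Prod>i=0..<r. A i (s i)) = 0" using that by (intro prod_zero) auto
    then show False using s(2) by simp
  qed
  then show ?thesis using that s(1) by blast
qed

lemma component_induct:
  assumes fin: "finite (E\<^sup>* `` {i})" and base: "P {i}"
    and step: "\<And>X j k. P X \<Longrightarrow> X \<subseteq> E\<^sup>* `` {i} \<Longrightarrow> j \<in> X \<Longrightarrow> (j, k) \<in> E \<Longrightarrow> k \<notin> X \<Longrightarrow> P (insert k X)"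
  shows "P (E\<^sup>* `` {i})"
proof -
  define F where "F = {X. X \<subseteq> E\<^sup>* `` {i} \<and> i \<in> X \<and> P X}"
  have "finite F" using finite_subset[of F "Pow (E\<^sup>* `` {i})"] fin by (auto simp: F_def)
  moreover have "{i} \<in> F" using base by (auto simp: F_def)
  ultimately obtain X where X: "X \<in> F" "\<And>Y. Y \<in> F \<Longrightarrow> X \<subseteq> Y \<Longrightarrow> Y = X"
    using finite_has_maximal[of F] by blast
  have closed: "k \<in> X" if j: "j \<in> X" "(j, k) \<in> E" for j k
  proof (rule ccontr)
    assume k: "k \<notin> X"
    have "k \<in> E\<^sup>* `` {i}" using j X(1) by (auto simp: F_def intro: rtrancl_into_rtrancl)
    then have "insert k X \<in> F" using step[OF _ _ j k] X(1) by (auto simp: F_def)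
    then show False using X(2)[of "insert k X"] k by blast
  qed
  have "E\<^sup>* `` {i} \<subseteq> X"
  proof
    fix k assume "k \<in> E\<^sup>* `` {i}"
    then have "(i, k) \<in> E\<^sup>*" by simp
    then show "k \<in> X" by (induction rule: rtrancl_induct) (use X(1) closed in \<open>auto simp: F_def\<close>)
  qed
  then show ?thesis using X(1) by (auto simp: F_def)
qed


text \<open>
  Rows and columns are pairs of a multi-index and a basis element, and an entry depends on the two
  multi-indices only through their difference, which has to be nonnegative.
\<close>

definition toeplitz_entry ::
  "(multi_index \<Rightarrow> 'e \<Rightarrow> 'e \<Rightarrow> 'r::zero) \<Rightarrow> multi_index \<times> 'e \<Rightarrow> multi_index \<times> 'e \<Rightarrow> 'r" where
  "toeplitz_entry \<phi> rw cl =
     (if \<exists>a. fst cl = a + fst rw then \<phi> (fst cl - fst rw) (snd rw) (snd cl) else 0)"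

lemma toeplitz_entry_nonzero:
  assumes "toeplitz_entry \<phi> rw cl \<noteq> 0"
  obtains a where "fst cl = a + fst rw" "\<phi> a (snd rw) (snd cl) \<noteq> 0"
  using assms unfolding toeplitz_entry_def by (auto split: if_splits)

text \<open>
  The combinatorial heart.  Join row \<open>i\<close> and column \<open>j\<close> if their entry is nonzero.  Each connected
  component can be translated on its own without changing its own entries; a component with \<open>k\<close> rows
  has a lower corner \<open>m\<close> of degree at least \<open>N - (k - 1) D\<close>, because the vertices of a component
  are reached from one row by steps of size at most \<open>D\<close>.  So there is room to decrease the total
  degree by one.

  Translated components may become joined to each other by new nonzero entries.  As \<open>c > 1\<close>, the
  degree of a component can be distributed freely between the first two coordinates.  The first
  coordinate is used to line up the components in disjoint intervals: the one of a component with \<open>k\<close>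
  rows has length at most \<open>k D\<close>.  An entry whose column comes from an earlier interval than its row
  is zero, so the translated matrix is block triangular with the old diagonal blocks.  The lower
  bound on the degree of the rows suffices for all these intervals together.
\<close>

lemma toeplitz_det_translate:
  fixes \<phi> :: "multi_index \<Rightarrow> 'e \<Rightarrow> 'e \<Rightarrow> 'r::comm_ring_1" and rw cl :: "nat \<Rightarrow> multi_index \<times> 'e"
  assumes c: "c > 1"
    and rw: "\<And>i. i < r \<Longrightarrow> fst (rw i) \<in> multi_indices c"
    and cl: "\<And>i. i < r \<Longrightarrow> fst (cl i) \<in> multi_indices c"
    and bound: "\<And>i j a. i < r \<Longrightarrow> j < r \<Longrightarrow> a \<in> multi_indices c \<Longrightarrow>
      \<phi> a (snd (rw i)) (snd (cl j)) \<noteq> 0 \<Longrightarrow> mdeg a \<le> D"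
    and large: "\<And>i. i < r \<Longrightarrow> (r - 1) * D + r \<le> mdeg (fst (rw i))"
    and nonzero: "det (mat r r (\<lambda>(i, j). toeplitz_entry \<phi> (rw i) (cl j))) \<noteq> 0"
  obtains \<beta>' \<beta> where
    "\<And>i. i < r \<Longrightarrow> \<beta>' i \<in> multi_indices c \<and> mdeg (\<beta>' i) + 1 = mdeg (fst (rw i))"
    "\<And>i. i < r \<Longrightarrow> \<beta> i \<in> multi_indices c \<and> mdeg (\<beta> i) + 1 = mdeg (fst (cl i))"
    "det (mat r r (\<lambda>(i, j). toeplitz_entry \<phi> (\<beta>' i, snd (rw i)) (\<beta> j, snd (cl j)))) =
     det (mat r r (\<lambda>(i, j). toeplitz_entry \<phi> (rw i) (cl j)))"
proof -
  let ?lk = Poly_Mapping.lookup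
  define A where "A i j = toeplitz_entry \<phi> (rw i) (cl j)" for i j
  obtain s where s: "s permutes {0..<r}" "\<And>i. i < r \<Longrightarrow> A i (s i) \<noteq> 0"
    using det_nonzero_permutation[of r A] nonzero unfolding A_def by auto
  have s_less: "s i < r" if "i < r" for i using permutes_in_image[OF s(1), of i] that by simp
  \<comment> \<open>vertex \<open>i\<close> stands for row \<open>i\<close> together with column \<open>s i\<close>\<close>
  define b' where "b' i = fst (rw i)" for i
  define b where "b i = fst (cl (s i))" for i
  have entry: "\<exists>a. b k = a + b' i \<and> mdeg a \<le> D" if ik: "i < r" "k < r" and A: "A i (s k) \<noteq> 0" for i k
  proof -
    obtain a where a: "b k = a + b' i" "\<phi> a (snd (rw i)) (snd (cl (s k))) \<noteq> 0"
      using A unfolding A_def b_def b'_def by (rule toeplitz_entry_nonzero)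
    have "a \<in> multi_indices c"
      using cl[OF s_less[OF ik(2)]] a(1) unfolding multi_indices_iff b_def by (simp add: lookup_add)
    then show ?thesis using a bound ik s_less by blast
  qed
  have entry_le: "?lk (b' i) t \<le> ?lk (b k) t \<and> ?lk (b k) t \<le> ?lk (b' i) t + D"
    and entry_diff: "(\<And>t. ?lk m t \<le> ?lk (b k) t) \<Longrightarrow> mdeg (m - b' i) \<le> D"
    if ik: "i < r" "k < r" "A i (s k) \<noteq> 0" for i k t m
  proof -
    obtain a where a: "b k = a + b' i" "mdeg a \<le> D" using entry[OF ik] by blast
    then show "?lk (b' i) t \<le> ?lk (b k) t \<and> ?lk (b k) t \<le> ?lk (b' i) t + D"
      using lookup_le_mdeg[of a t] by (simp add: lookup_add)
    assume "\<And>t. ?lk m t \<le> ?lk (b k) t"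
    then have "?lk (m - b' i) t \<le> ?lk a t" for t by (simp add: lookup_minus a(1) lookup_add le_diff_conv)
    then show "mdeg (m - b' i) \<le> D" using mdeg_mono[of "m - b' i" a] a(2) by simp
  qed
  define E where "E = {(i, k). i < r \<and> k < r \<and> (A i (s k) \<noteq> 0 \<or> A k (s i) \<noteq> 0)}"
  define comp where "comp i = E\<^sup>* `` {i}" for i
  have "sym E" by (auto simp: E_def sym_def)
  have comp_refl: "i \<in> comp i" for i by (simp add: comp_def)
  have comp_eq: "comp i = comp k" if "(i, k) \<in> E\<^sup>*" for i k
  proof -
    have "(k, i) \<in> E\<^sup>*" using sym_rtrancl[OF \<open>sym E\<close>] that by (rule symD)
    then show ?thesis using that rtrancl_trans[of _ _ E] unfolding comp_def by blast
  qed
  have comp_sub: "comp i \<subseteq> {0..<r}" if "i < r" for i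
  proof
    fix k assume "k \<in> comp i"
    then have "(i, k) \<in> E\<^sup>*" by (simp add: comp_def)
    then show "k \<in> {0..<r}" by (induction rule: rtrancl_induct) (use that in \<open>auto simp: E_def\<close>)
  qed
  have comp_finite: "finite (comp i)" if "i < r" for i using comp_sub[OF that] finite_subset by blast
  have comp_card: "card (comp i) \<le> r" "card (comp i) \<ge> 1" if "i < r" for i
    using card_mono[OF _ comp_sub[OF that]] card_gt_0_iff[of "comp i"] comp_finite[OF that] comp_refl[of i]
    by auto
  define N where "N = (r - 1) * D + r"
  \<comment> \<open>growing a component by one vertex lowers its corner by at most \<open>D\<close> and widens it by at most \<open>D\<close>\<close>
  define corner where "corner X m \<longleftrightarrow> m \<in> multi_indices c \<and>
      (\<forall>k\<in>X. (\<forall>t. ?lk m t \<le> ?lk (b' k) t) \<and> ?lk (b k) 0 \<le> ?lk m 0 + card X * D) \<and>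
      N \<le> mdeg m + (card X - 1) * D" for X m
  have "\<exists>m. corner (comp i) m" if i: "i < r" for i
    unfolding comp_def
  proof (rule component_induct)
    show "finite (E\<^sup>* `` {i})" using comp_finite[OF i] unfolding comp_def .
    show "\<exists>m. corner {i} m"
      using rw[OF i] large[OF i] entry_le[OF i i s(2)[OF i], of 0]
      by (intro exI[of _ "b' i"]) (auto simp: corner_def N_def b'_def)
  next
    fix X j k
    assume X: "\<exists>m. corner X m" "X \<subseteq> E\<^sup>* `` {i}" and j: "j \<in> X" and jk: "(j, k) \<in> E" and k: "k \<notin> X"
    have kr: "k < r" and jr: "j < r" using jk by (auto simp: E_def)
    have X_finite: "finite X" using X(2) comp_finite[OF i] finite_subset unfolding comp_def by blast
    have card: "card (insert k X) = Suc (card X)" "card X \<ge> 1"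
      using X_finite k j card_gt_0_iff[of X] by auto
    obtain m where m: "m \<in> multi_indices c" "\<And>k t. k \<in> X \<Longrightarrow> ?lk m t \<le> ?lk (b' k) t"
        "\<And>k. k \<in> X \<Longrightarrow> ?lk (b k) 0 \<le> ?lk m 0 + card X * D" "N \<le> mdeg m + (card X - 1) * D"
      using X(1) by (auto simp: corner_def)
    \<comment> \<open>the coordinatewise minimum of \<open>m\<close> and \<open>b' k\<close>\<close>
    define m' where "m' = m - (m - b' k)"
    have m': "?lk m' t = min (?lk m t) (?lk (b' k) t)" for t by (simp add: m'_def lookup_minus)
    have near: "mdeg (m - b' k) \<le> D \<and> ?lk (b k) 0 \<le> ?lk m 0 + card X * D + D"
    proof -
      consider (below) "A j (s k) \<noteq> 0" | (above) "A k (s j) \<noteq> 0" using jk by (auto simp: E_def)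
      then show ?thesis
      proof cases
        case below
        note jk_le = entry_le[OF jr kr below]
        have "mdeg (m - b' k) \<le> D"
          using m(2)[OF j] jk_le by (intro entry_diff[OF kr kr s(2)[OF kr]]) (meson le_trans)
        moreover have "?lk (b k) 0 \<le> ?lk m 0 + card X * D + D"
          using jk_le[of 0] entry_le[OF jr jr s(2)[OF jr], of 0] m(3)[OF j] by linarith
        ultimately show ?thesis by blast
      next
        case above
        note jj_le = entry_le[OF jr jr s(2)[OF jr]]
        have "mdeg (m - b' k) \<le> D"
          using m(2)[OF j] jj_le by (intro entry_diff[OF kr jr above]) (meson le_trans)
        moreover have "?lk (b k) 0 \<le> ?lk m 0 + card X * D + D"
          using entry_le[OF kr jr above, of 0] entry_le[OF kr kr s(2)[OF kr], of 0] m(3)[OF j] by linarith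
        ultimately show ?thesis by blast
      qed
    qed
    have "corner (insert k X) m'"
      unfolding corner_def
    proof (intro conjI ballI allI)
      show "m' \<in> multi_indices c" using m(1) unfolding multi_indices_iff by (simp add: m')
      show "?lk m' t \<le> ?lk (b' k') t" if "k' \<in> insert k X" for k' t
        using that m(2)[of k' t] by (auto simp: m')
      have "mdeg m = mdeg (m - (m - b' k) + (m - b' k))"
        by (subst multi_index_decompose[of "m - b' k" m, symmetric]) (auto simp: lookup_minus)
      then have "mdeg m \<le> mdeg m' + D" using near by (simp add: m'_def mdeg_add)
      moreover have "(card (insert k X) - 1) * D = (card X - 1) * D + D" using card by (cases "card X") auto
      ultimately show "N \<le> mdeg m' + (card (insert k X) - 1) * D" using m(4) by linarith
      fix k' assume k': "k' \<in> insert k X"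
      have "?lk m 0 - ?lk (b' k) 0 \<le> D"
        using lookup_le_mdeg[of "m - b' k" 0] near unfolding lookup_minus by linarith
      then have lower: "?lk m 0 \<le> ?lk m' 0 + D" unfolding m' by linarith
      have "?lk (b k') 0 \<le> ?lk m' 0 + card X * D + D"
      proof (cases "k' = k")
        case True
        moreover have "?lk (b k) 0 \<le> ?lk m' 0 + card X * D + D"
          using near entry_le[OF kr kr s(2)[OF kr], of 0] unfolding m' by linarith
        ultimately show ?thesis by simp
      next
        case False
        then show ?thesis using k' m(3)[of k'] lower by simp
      qed
      then show "?lk (b k') 0 \<le> ?lk m' 0 + card (insert k X) * D" by (simp add: card(1))
    qed
    then show "\<exists>m. corner (insert k X) m" by blast
  qed
  then have "\<forall>K\<in>comp ` {0..<r}. \<exists>m. corner K m" by auto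
  then have "\<exists>M. \<forall>K\<in>comp ` {0..<r}. corner K (M K)" by (rule bchoice)
  then obtain M where "\<forall>K\<in>comp ` {0..<r}. corner K (M K)" by blast
  then have M: "\<And>i. i < r \<Longrightarrow> corner (comp i) (M (comp i))" by auto
  define label where "label i = Min (comp i)" for i
  have label_in: "label i \<in> comp i" if "i < r" for i
    unfolding label_def using comp_finite[OF that] comp_refl by (intro Min_in) auto
  have label_eq: "label i = label k \<longleftrightarrow> comp i = comp k" if "i < r" "k < r" for i k
  proof
    assume eq: "label i = label k"
    have "(i, label i) \<in> E\<^sup>*" "(k, label i) \<in> E\<^sup>*"
      using label_in[OF that(1)] label_in[OF that(2)] by (simp_all add: comp_def flip: eq)
    then show "comp i = comp k" using comp_eq[of i "label i"] comp_eq[of k "label i"] by simp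
  qed (simp add: label_def)
  \<comment> \<open>each vertex of an earlier component reserves \<open>D + 1\<close> places, one more than it adds to the width, to keep the intervals disjoint\<close>
  define pos where "pos i = (D + 1) * card {k. k < r \<and> label k < label i}" for i
  have pos_le: "pos i + (D + 1) * card (comp i) \<le> (D + 1) * card {j. j < r \<and> label j \<le> label i}" if i: "i < r" for i
  proof -
    have label_comp: "label k = label i" if "k \<in> comp i" for k
      using comp_eq[of i k] that by (simp add: label_def comp_def)
    have "card {k. k < r \<and> label k < label i} + card (comp i) = card ({k. k < r \<and> label k < label i} \<union> comp i)"
    proof (rule card_Un_disjoint[symmetric])
      show "{k. k < r \<and> label k < label i} \<inter> comp i = {}"
        using label_comp by (auto simp: disjoint_iff)
    qed (use comp_finite[OF i] in auto)
    also have "\<dots> \<le> card {j. j < r \<and> label j \<le> label i}"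
      using label_comp comp_sub[OF i] by (intro card_mono) auto
    finally show ?thesis unfolding pos_def unfolding add_mult_distrib2[symmetric] by (rule mult_le_mono2)
  qed
  have pos_less: "pos i + (D + 1) * card (comp i) \<le> pos k" if ik: "i < r" "label i < label k" for i k
  proof -
    have "card {j. j < r \<and> label j \<le> label i} \<le> card {j. j < r \<and> label j < label k}"
      using ik(2) by (intro card_mono) auto
    then have "(D + 1) * card {j. j < r \<and> label j \<le> label i} \<le> pos k"
      unfolding pos_def by (rule mult_le_mono2)
    then show ?thesis using pos_le[OF ik(1)] by linarith
  qed
  have pos_small: "pos i + 1 \<le> mdeg (M (comp i))" if i: "i < r" for i
  proof -
    have "card {j. j < r \<and> label j \<le> label i} \<le> card {0..<r}" by (intro card_mono) auto
    then have "(D + 1) * card {j. j < r \<and> label j \<le> label i} \<le> (D + 1) * r" by (intro mult_le_mono2) simp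
    then have "pos i + (D + 1) * card (comp i) \<le> (D + 1) * r" using pos_le[OF i] by linarith
    moreover have "N \<le> mdeg (M (comp i)) + (card (comp i) - 1) * D" using M[OF i] by (simp add: corner_def)
    moreover obtain q where q: "card (comp i) = Suc q" using comp_card(2)[OF i] by (cases "card (comp i)") auto
    moreover obtain p where p: "r = Suc p" using i by (cases r) auto
    ultimately have "pos i + (D * q + D + q + 1) \<le> D * p + D + p + 1"
        "D * p + p + 1 \<le> mdeg (M (comp i)) + D * q"
      by (simp_all add: N_def algebra_simps)
    then show ?thesis by linarith
  qed
  \<comment> \<open>every component is moved as a whole, its corner going to the prescribed first coordinate\<close>
  define V :: "nat \<Rightarrow> multi_index" where "V i = Poly_Mapping.single 0 (pos i) + Poly_Mapping.single 1 (mdeg (M (comp i)) - 1 - pos i)" for i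
  define move where "move i a = (a - M (comp i)) + V i" for i a
  have V: "V i \<in> multi_indices c" "mdeg (V i) + 1 = mdeg (M (comp i))" "?lk (V i) 0 = pos i" if "i < r" for i
    using c pos_small[OF that]
    by (auto simp: V_def multi_indices_iff lookup_add lookup_single mdeg_add mdeg_single when_def)
  have M_le: "?lk (M (comp i)) t \<le> ?lk (b' i) t" "?lk (M (comp i)) t \<le> ?lk (b i) t" if "i < r" for i t
    using M[OF that] comp_refl[of i] entry_le[OF that that s(2)[OF that], of t] unfolding corner_def
    by (auto intro: le_trans)
  have move: "move i a \<in> multi_indices c" "mdeg (move i a) + 1 = mdeg a"
    if i: "i < r" and a: "a \<in> multi_indices c" "\<And>t. ?lk (M (comp i)) t \<le> ?lk a t" for i a
  proof -
    show "move i a \<in> multi_indices c"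
      using V(1)[OF i] a(1) unfolding multi_indices_iff by (simp add: move_def lookup_add lookup_minus)
    show "mdeg (move i a) + 1 = mdeg a"
      using V(2)[OF i] arg_cong[OF multi_index_decompose[OF a(2)], of mdeg]
      by (simp add: move_def mdeg_add)
  qed
  define n where "n = inv_into UNIV s"
  have n: "n j < r" "s (n j) = j" if "j < r" for j
    using that permutes_in_image[OF permutes_inv[OF s(1)], of j] permutes_inverses[OF s(1)] by (auto simp: n_def)
  define \<beta>' where "\<beta>' i = move i (fst (rw i))" for i
  define \<beta> where "\<beta> j = move (n j) (fst (cl j))" for j
  have b_col: "fst (cl j) = b (n j)" if "j < r" for j using n(2)[OF that] by (simp add: b_def)
  define A' where "A' i j = toeplitz_entry \<phi> (\<beta>' i, snd (rw i)) (\<beta> j, snd (cl j))" for i j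
  have "det (mat r r (\<lambda>(i, j). A' i j)) = det (mat r r (\<lambda>(i, j). A i j))"
  proof (rule det_eq_block_triangular[OF s(1), of label "\<lambda>j. label (n j)"])
    show "label i = label (n (s i))" for i
      using permutes_inverses[OF s(1)] by (simp add: n_def)
  next
    fix i j assume ij: "i < r" "j < r"
    note nj = n[OF ij(2)]
    {
      assume "A i j \<noteq> 0"
      then have "(i, n j) \<in> E" using ij nj by (auto simp: E_def)
      then have "comp i = comp (n j)" by (intro comp_eq) auto
      then show "label i = label (n j)" by (simp add: label_def)
    next
      assume "label i = label (n j)"
      then have eq: "comp i = comp (n j)" using label_eq ij(1) nj(1) by blast
      then have "V i = V (n j)" by (simp add: V_def pos_def label_def)
      define m where "m = M (comp i)"
      have le: "?lk m t \<le> ?lk (fst (rw i)) t" "?lk m t \<le> ?lk (fst (cl j)) t" for t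
        using M_le(1)[OF ij(1)] M_le(2)[OF nj(1)] b_col[OF ij(2)] eq by (auto simp: m_def b'_def)
      have \<beta>: "\<beta>' i = (fst (rw i) - m) + V i" "\<beta> j = (fst (cl j) - m) + V i"
        using eq \<open>V i = V (n j)\<close> by (simp_all add: \<beta>'_def \<beta>_def move_def m_def)
      have "\<beta> j = a + \<beta>' i \<longleftrightarrow> fst (cl j) = a + fst (rw i)" for a
      proof -
        have "\<beta> j = a + \<beta>' i \<longleftrightarrow> fst (cl j) - m = a + (fst (rw i) - m)"
          by (simp add: \<beta> flip: add.assoc)
        also have "\<dots> \<longleftrightarrow> (fst (cl j) - m) + m = a + ((fst (rw i) - m) + m)"
          by (simp flip: add.assoc)
        finally show ?thesis using multi_index_decompose[of m] le by metis
      qed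
      moreover from this have "\<beta> j - \<beta>' i = fst (cl j) - fst (rw i)" if "fst (cl j) = a + fst (rw i)" for a
        using that by (metis add_diff_cancel_right')
      ultimately show "A' i j = A i j"
        unfolding A'_def A_def toeplitz_entry_def by auto
    next
      assume less: "label (n j) < label i"
      have "?lk (b (n j)) 0 \<le> ?lk (M (comp (n j))) 0 + card (comp (n j)) * D"
        using M[OF nj(1)] comp_refl[of "n j"] by (simp add: corner_def)
      then have "?lk (\<beta> j) 0 \<le> pos (n j) + card (comp (n j)) * D"
        using V(3)[OF nj(1)] by (simp add: \<beta>_def move_def b_col[OF ij(2)] lookup_add lookup_minus)
      also have "\<dots> < pos (n j) + (D + 1) * card (comp (n j))" using comp_card(2)[OF nj(1)] by simp
      also have "\<dots> \<le> pos i" by (rule pos_less[OF nj(1) less])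
      also have "\<dots> \<le> ?lk (\<beta>' i) 0" using V(3)[OF ij(1)] by (simp add: \<beta>'_def move_def lookup_add)
      finally have "\<beta> j \<noteq> a + \<beta>' i" for a by (auto simp: lookup_add)
      then show "A' i j = 0" by (simp add: A'_def toeplitz_entry_def)
    }
  qed
  moreover have "\<beta>' i \<in> multi_indices c \<and> mdeg (\<beta>' i) + 1 = mdeg (fst (rw i))" if "i < r" for i
    unfolding \<beta>'_def using move[OF that rw[OF that]] M_le(1)[OF that] by (simp add: b'_def)
  moreover have "\<beta> j \<in> multi_indices c \<and> mdeg (\<beta> j) + 1 = mdeg (fst (cl j))" if "j < r" for j
    unfolding \<beta>_def using move[OF n(1)[OF that] cl[OF that]] M_le(2)[OF n(1)[OF that]] by (simp add: b_col[OF that])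
  ultimately show ?thesis by (intro that[of \<beta>' \<beta>]) (auto simp: A_def A'_def)
qed

section \<open>Minors of the Shamash complex\<close>

definition sh_index :: "nat \<Rightarrow> (int \<Rightarrow> 'g set) \<Rightarrow> int \<Rightarrow> (multi_index \<times> 'g) set" where
  "sh_index c B l = {(b, e). b \<in> multi_indices c \<and> e \<in> B (l - 2 * int (mdeg b))}"

lemma sh_basis_eq_image: "sh_basis c B l = (\<lambda>k. Poly_Mapping.single k 1) ` sh_index c B l"
  by (auto simp: sh_basis_def sh_index_def)

lemma single_one_eq_iff:
  "(Poly_Mapping.single k 1 :: 'k \<Rightarrow>\<^sub>0 'r::zero_neq_one) = Poly_Mapping.single k' 1 \<longleftrightarrow> k = k'"
proof
  assume eq: "(Poly_Mapping.single k 1 :: 'k \<Rightarrow>\<^sub>0 'r) = Poly_Mapping.single k' 1"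
  have "Poly_Mapping.lookup (Poly_Mapping.single k' 1 :: 'k \<Rightarrow>\<^sub>0 'r) k = 1"
    unfolding eq[symmetric] by simp
  then show "k = k'" by (simp add: lookup_single when_def split: if_splits)
qed simp

lemma sh_representation:
  fixes z :: "('g::ab_group_add, 'r::comm_ring_1) shamash"
  assumes B: "graded_free sc B" "\<forall>j<0. B j = {}"
    and z: "z \<in> Modules.module.span sh_scale (\<Union>l. sh_basis c B l)"
    and k: "k \<in> sh_index c B l"
  shows "Modules.module.representation sh_scale (\<Union>l. sh_basis c B l) z (Poly_Mapping.single k 1) =
    Poly_Mapping.lookup z k"
proof -
  interpret sh: Modules.module "sh_scale :: 'r \<Rightarrow> ('g, 'r) shamash \<Rightarrow> ('g, 'r) shamash"
    by (rule module_sh_scale)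
  let ?B = "\<Union>l. sh_basis c B l :: ('g, 'r) shamash set"
  have "graded_free sh_scale (sh_basis c B :: int \<Rightarrow> ('g, 'r) shamash set)"
    by (rule graded_free_shamash[OF B])
  then have indep: "sh.independent ?B" by (simp add: graded_free_def)
  have "z \<in> sh.span ?B \<and>
    sh.representation ?B z (Poly_Mapping.single k 1) = Poly_Mapping.lookup z k"
    using z
  proof (induction rule: sh.span_induct_alt)
    case base
    then show ?case by (simp add: sh.representation_zero sh.span_zero)
  next
    case (step s x y)
    obtain k' where k': "x = Poly_Mapping.single k' 1"
      using step(1) by (auto simp: sh_basis_eq_image)
    have x: "x \<in> sh.span ?B" using step(1) by (rule sh.span_base)
    have "sh.representation ?B x (Poly_Mapping.single k 1) = Poly_Mapping.lookup x k"
      by (subst sh.representation_basis[OF indep step(1)])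
        (auto simp: k' single_one_eq_iff lookup_single when_def)
    then show ?case
      using step(2) x by (simp add: sh.span_add sh.span_scale sh.representation_add[OF indep]
          sh.representation_scale[OF indep] lookup_add lookup_sh_scale)
  qed
  then show ?thesis by blast
qed

context graded_free_module
begin

lemma lookup_sh_tensor:
  assumes "\<pi> 0 = (0 :: 'r::comm_ring_1)"
  shows "Poly_Mapping.lookup (sh_tensor \<pi> sc B b g) (b', e) = (if b' = b then \<pi> (coord g e) else 0)"
proof -
  have "Poly_Mapping.lookup (sh_tensor \<pi> sc B b g) (b', e) =
      (\<Sum>e' | coord g e' \<noteq> 0. if e' = e then (if b' = b then \<pi> (coord g e) else 0) else 0)"
    unfolding sh_tensor_def lookup_sum
    by (rule sum.cong) (auto simp: lookup_single when_def)
  then show ?thesis using finite_representation[of "\<Union>j. B j" g] assms by auto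
qed

lemma sh_tensor_in_span:
  fixes \<pi> :: "'a \<Rightarrow> 'r::comm_ring_1"
  assumes "b \<in> multi_indices c"
  shows "sh_tensor \<pi> sc B b g \<in> Modules.module.span sh_scale (\<Union>l. sh_basis c B l)"
proof -
  interpret sh: Modules.module "sh_scale :: 'r \<Rightarrow> ('g, 'r) shamash \<Rightarrow> ('g, 'r) shamash"
    by (rule module_sh_scale)
  show ?thesis
    unfolding sh_tensor_def
  proof (rule sh.span_sum)
    fix e assume "e \<in> {e. coord g e \<noteq> 0}"
    then obtain j where "e \<in> B j" using representation_ne_zero[of "\<Union>j. B j" g e] by auto
    then have "Poly_Mapping.single (b, e) 1 \<in> (sh_basis c B (j + 2 * int (mdeg b)) :: ('g, 'r) shamash set)"
      using assms unfolding sh_basis_def by (intro CollectI exI[of _ b] exI[of _ e]) simp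
    then have "sh_scale (\<pi> (coord g e)) (Poly_Mapping.single (b, e) 1) \<in> sh.span (\<Union>l. sh_basis c B l)"
      by (intro sh.span_scale sh.span_base) blast
    moreover have "sh_scale (\<pi> (coord g e)) (Poly_Mapping.single (b, e) 1) = Poly_Mapping.single (b, e) (\<pi> (coord g e))"
      by (rule poly_mapping_eqI) (simp add: lookup_sh_scale lookup_single when_def)
    ultimately show "Poly_Mapping.single (b, e) (\<pi> (coord g e)) \<in> sh.span (\<Union>l. sh_basis c B l)" by simp
  qed
qed

lemma sh_diff_matrix_entry:
  fixes \<pi> :: "'a \<Rightarrow> 'r::comm_ring_1"
  assumes \<pi>: "\<pi> 0 = 0" and neg: "\<forall>j<0. B j = {}"
    and row: "k' \<in> sh_index c B l'" and col: "k \<in> sh_index c B l"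
  shows "Modules.module.representation sh_scale (\<Union>l. sh_basis c B l)
      (sh_diff \<pi> sc B \<sigma> (Poly_Mapping.single k 1)) (Poly_Mapping.single k' 1) =
    toeplitz_entry (\<lambda>a e' e. \<pi> (coord (\<sigma> a e) e')) k' k"
proof -
  interpret sh: Modules.module "sh_scale :: 'r \<Rightarrow> ('g, 'r) shamash \<Rightarrow> ('g, 'r) shamash"
    by (rule module_sh_scale)
  obtain b e b' e' where k: "k = (b, e)" "k' = (b', e')" by (cases k, cases k')
  have b: "b \<in> multi_indices c" using col by (simp add: sh_index_def k)
  have diff: "sh_diff \<pi> sc B \<sigma> (Poly_Mapping.single k 1) =
      (\<Sum>(a, b'')\<in>{(a, b''). a + b'' = b}. sh_tensor \<pi> sc B b'' (\<sigma> a e))"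
    by (simp add: sh_diff_def k)
  have "sh_diff \<pi> sc B \<sigma> (Poly_Mapping.single k 1) \<in> sh.span (\<Union>l. sh_basis c B l)"
    unfolding diff
  proof (intro sh.span_sum, clarify)
    fix a b'' assume "b = a + b''"
    then have "b'' \<in> multi_indices c" using b by (simp add: multi_indices_iff lookup_add)
    then show "sh_tensor \<pi> sc B b'' (\<sigma> a e) \<in> sh.span (\<Union>l. sh_basis c B l)" by (rule sh_tensor_in_span)
  qed
  then have "sh.representation (\<Union>l. sh_basis c B l) (sh_diff \<pi> sc B \<sigma> (Poly_Mapping.single k 1))
      (Poly_Mapping.single k' 1) = Poly_Mapping.lookup (sh_diff \<pi> sc B \<sigma> (Poly_Mapping.single k 1)) k'"
    using sh_representation[OF graded neg _ row] by blast
  also have "\<dots> = (\<Sum>(a, b'')\<in>{(a, b''). a + b'' = b}. if b' = b'' then \<pi> (coord (\<sigma> a e) e') else 0)"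
    unfolding diff k(2) lookup_sum by (rule sum.cong) (auto simp: lookup_sh_tensor[of \<pi>, OF \<pi>])
  also have "\<dots> = (\<Sum>p\<in>{(a, b''). a + b'' = b}. if p = (b - b', b') then \<pi> (coord (\<sigma> (b - b') e) e') else 0)"
    by (rule sum.cong) (auto split: if_splits)
  also have "\<dots> = (if (b - b') + b' = b then \<pi> (coord (\<sigma> (b - b') e) e') else 0)"
    using finite_splittings[of b] by simp
  also have "\<dots> = toeplitz_entry (\<lambda>a e' e. \<pi> (coord (\<sigma> a e) e')) k' k"
    unfolding toeplitz_entry_def k by (auto simp: eq_commute[of b])
  finally show ?thesis .
qed

end

text \<open>
  Rows and columns may be repeated here: this only adds the minor zero, and translated rows and
  columns need not be known to be distinct.
\<close>

definition toeplitz_minors :: "(multi_index \<Rightarrow> 'g \<Rightarrow> 'g \<Rightarrow> 'r::comm_ring_1) \<Rightarrow> nat \<Rightarrow> (int \<Rightarrow> 'g set) \<Rightarrow>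
    nat \<Rightarrow> int \<Rightarrow> 'r set" where
  "toeplitz_minors \<phi> c B r l =
     {det (mat r r (\<lambda>(i, j). toeplitz_entry \<phi> (\<rho> i) (\<kappa> j))) | \<rho> \<kappa>.
        (\<forall>i<r. \<rho> i \<in> sh_index c B (l - 1)) \<and> (\<forall>i<r. \<kappa> i \<in> sh_index c B l)}"

lemma det_nonzero_inj:
  fixes F :: "'x \<Rightarrow> 'y \<Rightarrow> 'r::comm_ring_1"
  assumes "det (mat r r (\<lambda>(i, j). F (\<rho> i) (\<kappa> j))) \<noteq> 0"
  shows "inj_on \<rho> {0..<r}" "inj_on \<kappa> {0..<r}"
proof -
  define A where "A = mat r r (\<lambda>(i, j). F (\<rho> i) (\<kappa> j))"
  have A: "A \<in> carrier_mat r r" "det A \<noteq> 0" using assms by (simp_all add: A_def)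
  show "inj_on \<rho> {0..<r}"
  proof (rule inj_onI, rule ccontr)
    fix i k assume ik: "i \<in> {0..<r}" "k \<in> {0..<r}" "\<rho> i = \<rho> k" "i \<noteq> k"
    then have "row A i = row A k" by (intro eq_vecI) (auto simp: A_def)
    then show False using A det_identical_rows[OF A(1), of i k] ik by simp
  qed
  show "inj_on \<kappa> {0..<r}"
  proof (rule inj_onI, rule ccontr)
    fix i k assume ik: "i \<in> {0..<r}" "k \<in> {0..<r}" "\<kappa> i = \<kappa> k" "i \<noteq> k"
    then have "col A i = col A k" by (intro eq_vecI) (auto simp: A_def)
    then show False using A det_identical_columns[OF A(1), of i k] ik by simp
  qed
qed

lemma (in graded_free_module) ideal_gen_sh_minors:
  fixes \<pi> :: "'a \<Rightarrow> 'r::comm_ring_1"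
  assumes \<pi>: "\<pi> 0 = 0" and neg: "\<forall>j<0. B j = {}"
  shows "ideal_gen (minors sh_scale (sh_basis c B) (sh_diff \<pi> sc B \<sigma>) r l) =
    ideal_gen (toeplitz_minors (\<lambda>a e' e. \<pi> (coord (\<sigma> a e) e')) c B r l)"
    (is "ideal_gen ?M = ideal_gen ?T")
proof (rule equalityI; rule ideal_gen_minimal[OF _ ring_ideal_ideal_gen]; rule subsetI)
  let ?\<phi> = "\<lambda>a e' e. \<pi> (coord (\<sigma> a e) e')"
  let ?rep = "Modules.module.representation sh_scale (\<Union>l. sh_basis c B l)"
  let ?S = "\<lambda>k. Poly_Mapping.single k 1 :: ('g, 'r) shamash"
  have entry: "?rep (sh_diff \<pi> sc B \<sigma> (?S k)) (?S k') = toeplitz_entry ?\<phi> k' k"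
    if "k' \<in> sh_index c B (l - 1)" "k \<in> sh_index c B l" for k k'
    by (rule sh_diff_matrix_entry[of \<pi>, OF \<pi> neg that])
  fix x
  {
    assume "x \<in> ?M"
    then obtain rs cs where x: "x = det (mat r r (\<lambda>(p, q). ?rep (sh_diff \<pi> sc B \<sigma> (cs ! q)) (rs ! p)))"
      and rs: "length rs = r" "set rs \<subseteq> sh_basis c B (l - 1)"
      and cs: "length cs = r" "set cs \<subseteq> sh_basis c B l"
      unfolding minors_def by blast
    have "\<exists>k. k \<in> sh_index c B (l - 1) \<and> rs ! p = ?S k" if "p < r" for p
      using subsetD[OF rs(2) nth_mem[of p rs]] rs(1) that unfolding sh_basis_eq_image by auto
    then obtain \<rho> where \<rho>: "p < r \<Longrightarrow> \<rho> p \<in> sh_index c B (l - 1) \<and> rs ! p = ?S (\<rho> p)" for p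
      by metis
    have "\<exists>k. k \<in> sh_index c B l \<and> cs ! p = ?S k" if "p < r" for p
      using subsetD[OF cs(2) nth_mem[of p cs]] cs(1) that unfolding sh_basis_eq_image by auto
    then obtain \<kappa> where \<kappa>: "p < r \<Longrightarrow> \<kappa> p \<in> sh_index c B l \<and> cs ! p = ?S (\<kappa> p)" for p
      by metis
    have "x = det (mat r r (\<lambda>(p, q). toeplitz_entry ?\<phi> (\<rho> p) (\<kappa> q)))"
      unfolding x using \<rho> \<kappa> by (intro arg_cong[of _ _ det] cong_mat) (auto simp: entry)
    then have "x \<in> ?T" unfolding toeplitz_minors_def using \<rho> \<kappa> by blast
    then show "x \<in> ideal_gen ?T" by (rule ideal_gen_base)
  next
    assume "x \<in> ?T"
    then obtain \<rho> \<kappa> where x: "x = det (mat r r (\<lambda>(i, j). toeplitz_entry ?\<phi> (\<rho> i) (\<kappa> j)))"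
      and \<rho>: "\<forall>i<r. \<rho> i \<in> sh_index c B (l - 1)" and \<kappa>: "\<forall>i<r. \<kappa> i \<in> sh_index c B l"
      unfolding toeplitz_minors_def by blast
    show "x \<in> ideal_gen ?M"
    proof (cases "x = 0")
      case True
      then show ?thesis using ring_ideal_0[OF ring_ideal_ideal_gen] by simp
    next
      case False
      have inj: "inj_on \<rho> {0..<r}" "inj_on \<kappa> {0..<r}"
        using det_nonzero_inj[of r "toeplitz_entry ?\<phi>" \<rho> \<kappa>] False x by simp_all
      have distinct_singles: "distinct (map (\<lambda>i. ?S (g i)) [0..<r])" if g: "inj_on g {0..<r}" for g
      proof -
        have "inj_on (\<lambda>i. ?S (g i)) {0..<r}"
          by (rule inj_onI) (rule inj_onD[OF g], unfold single_one_eq_iff)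
        then show ?thesis by (simp add: distinct_map)
      qed
      define rs where "rs = map (\<lambda>i. ?S (\<rho> i)) [0..<r]"
      define cs where "cs = map (\<lambda>i. ?S (\<kappa> i)) [0..<r]"
      have "x = det (mat r r (\<lambda>(p, q). ?rep (sh_diff \<pi> sc B \<sigma> (cs ! q)) (rs ! p)))"
        unfolding x using \<rho> \<kappa>
        by (intro arg_cong[of _ _ det] cong_mat) (auto simp: rs_def cs_def entry)
      moreover have "distinct rs" "distinct cs"
        unfolding rs_def cs_def by (rule distinct_singles, rule inj)+
      moreover have "set rs \<subseteq> sh_basis c B (l - 1)" "set cs \<subseteq> sh_basis c B l"
        using \<rho> \<kappa> by (auto simp: rs_def cs_def sh_basis_eq_image)
      moreover have "length rs = r" "length cs = r" by (simp_all add: rs_def cs_def)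
      ultimately have "x \<in> ?M" unfolding minors_def by blast
      then show ?thesis by (rule ideal_gen_base)
    qed
  }
qed

text \<open>
  Adding a unit vector to all multi-indices changes no entry.
\<close>

lemma toeplitz_minors_mono:
  fixes B :: "int \<Rightarrow> 'g set"
  assumes "c > 0"
  shows "toeplitz_minors \<phi> c B r l \<subseteq> toeplitz_minors \<phi> c B r (l + 2)"
proof
  fix x assume "x \<in> toeplitz_minors \<phi> c B r l"
  then obtain \<rho> \<kappa> where x: "x = det (mat r r (\<lambda>(i, j). toeplitz_entry \<phi> (\<rho> i) (\<kappa> j)))"
    and \<rho>: "\<forall>i<r. \<rho> i \<in> sh_index c B (l - 1)" and \<kappa>: "\<forall>i<r. \<kappa> i \<in> sh_index c B l"
    unfolding toeplitz_minors_def by blast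
  define up :: "multi_index \<times> 'g \<Rightarrow> multi_index \<times> 'g" where
    "up = (\<lambda>(b, e). (b + Poly_Mapping.single 0 1, e))"
  have up: "up k \<in> sh_index c B (i + 2)" if "k \<in> sh_index c B i" for k i
    using that assms
    by (auto simp: up_def sh_index_def mdeg_add mdeg_single multi_indices_iff lookup_add lookup_single when_def algebra_simps)
  have "toeplitz_entry \<phi> (up k') (up k) = toeplitz_entry \<phi> k' k" for k k'
    by (cases k; cases k') (simp add: up_def toeplitz_entry_def flip: add.assoc)
  then have "x = det (mat r r (\<lambda>(i, j). toeplitz_entry \<phi> ((up \<circ> \<rho>) i) ((up \<circ> \<kappa>) j)))"
    by (simp add: x)
  moreover have "\<forall>i<r. (up \<circ> \<rho>) i \<in> sh_index c B (l + 2 - 1)" "\<forall>i<r. (up \<circ> \<kappa>) i \<in> sh_index c B (l + 2)"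
    using \<rho> \<kappa> up[of _ "l - 1"] up[of _ l] by (auto simp: algebra_simps)
  ultimately show "x \<in> toeplitz_minors \<phi> c B r (l + 2)" unfolding toeplitz_minors_def by blast
qed

text \<open>
  Since \<open>B\<close> lives in degrees between \<open>0\<close> and \<open>d\<close>, a homotopy \<open>\<phi> a\<close> of degree \<open>2 * mdeg a - 1\<close> is zero
  unless \<open>mdeg a \<le> (d + 1) / 2\<close>, and the multi-indices of rows in a large degree are large.  Both
  bounds together allow the translation of any nonzero minor.
\<close>

lemma toeplitz_minors_descend:
  assumes c: "c > 1"
    and length: "\<And>j. B j \<noteq> {} \<Longrightarrow> 0 \<le> j \<and> j \<le> int d"
    and degree: "\<And>a i e e'. a \<in> multi_indices c \<Longrightarrow> e \<in> B i \<Longrightarrow> \<phi> a e' e \<noteq> 0 \<Longrightarrow> e' \<in> B (i + 2 * int (mdeg a) - 1)"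
    and l: "l \<ge> int (r * d + 4 * (r - 1) + 1)"
  shows "toeplitz_minors \<phi> c B r (l + 2) \<subseteq> insert 0 (toeplitz_minors \<phi> c B r l)"
proof
  fix x assume "x \<in> toeplitz_minors \<phi> c B r (l + 2)"
  then obtain \<rho> \<kappa> where x: "x = det (mat r r (\<lambda>(i, j). toeplitz_entry \<phi> (\<rho> i) (\<kappa> j)))"
    and \<rho>: "\<And>i. i < r \<Longrightarrow> \<rho> i \<in> sh_index c B (l + 2 - 1)" and \<kappa>: "\<And>i. i < r \<Longrightarrow> \<kappa> i \<in> sh_index c B (l + 2)"
    unfolding toeplitz_minors_def by blast
  define D where "D = (d + 1) div 2"
  show "x \<in> insert 0 (toeplitz_minors \<phi> c B r l)"
  proof (cases "x = 0")
    case False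
    obtain \<beta>' \<beta> where
      \<beta>': "\<And>i. i < r \<Longrightarrow> \<beta>' i \<in> multi_indices c \<and> mdeg (\<beta>' i) + 1 = mdeg (fst (\<rho> i))" and
      \<beta>: "\<And>i. i < r \<Longrightarrow> \<beta> i \<in> multi_indices c \<and> mdeg (\<beta> i) + 1 = mdeg (fst (\<kappa> i))" and
      det: "det (mat r r (\<lambda>(i, j). toeplitz_entry \<phi> (\<beta>' i, snd (\<rho> i)) (\<beta> j, snd (\<kappa> j)))) =
        det (mat r r (\<lambda>(i, j). toeplitz_entry \<phi> (\<rho> i) (\<kappa> j)))"
    proof (rule toeplitz_det_translate[OF c, of r \<rho> \<kappa> \<phi> D])
      show "fst (\<rho> i) \<in> multi_indices c" "fst (\<kappa> i) \<in> multi_indices c" if "i < r" for i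
        using \<rho>[OF that] \<kappa>[OF that] by (auto simp: sh_index_def)
      show "mdeg a \<le> D" if ij: "i < r" "j < r" and a: "a \<in> multi_indices c" "\<phi> a (snd (\<rho> i)) (snd (\<kappa> j)) \<noteq> 0" for i j a
      proof -
        define k where "k = l + 2 - 2 * int (mdeg (fst (\<kappa> j)))"
        have e: "snd (\<kappa> j) \<in> B k" using \<kappa>[OF ij(2)] by (auto simp: sh_index_def k_def)
        then have "snd (\<rho> i) \<in> B (k + 2 * int (mdeg a) - 1)" using degree a by blast
        then have "k + 2 * int (mdeg a) - 1 \<le> int d" "0 \<le> k" using length e by blast+
        then show ?thesis unfolding D_def by linarith
      qed
      show "(r - 1) * D + r \<le> mdeg (fst (\<rho> i))" if i: "i < r" for i
      proof -
        obtain q where q: "r = Suc q" using i by (cases r) auto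
        have "B (l + 2 - 1 - 2 * int (mdeg (fst (\<rho> i)))) \<noteq> {}" using \<rho>[OF i] by (auto simp: sh_index_def)
        then have "l + 1 - 2 * int (mdeg (fst (\<rho> i))) \<le> int d" using length by fastforce
        then have "int (q * d + 4 * q + 2) \<le> int (2 * mdeg (fst (\<rho> i)))" using l by (simp add: q algebra_simps)
        then have "q * d + 4 * q + 2 \<le> 2 * mdeg (fst (\<rho> i))" by linarith
        moreover have "q * (2 * D) \<le> q * (d + 1)" unfolding D_def by (intro mult_le_mono2) simp
        ultimately show ?thesis by (simp add: q algebra_simps)
      qed
      show "det (mat r r (\<lambda>(i, j). toeplitz_entry \<phi> (\<rho> i) (\<kappa> j))) \<noteq> 0" using False x by simp
    qed (rule that)
    have "(\<beta>' i, snd (\<rho> i)) \<in> sh_index c B (l - 1)" "(\<beta> i, snd (\<kappa> i)) \<in> sh_index c B l" if "i < r" for i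
    proof -
      have shift: "l + 2 - 1 - 2 * int (mdeg (fst (\<rho> i))) = l - 1 - 2 * int (mdeg (\<beta>' i))"
        "l + 2 - 2 * int (mdeg (fst (\<kappa> i))) = l - 2 * int (mdeg (\<beta> i))"
        using \<beta>'[OF that] \<beta>[OF that] by linarith+
      have "snd (\<rho> i) \<in> B (l + 2 - 1 - 2 * int (mdeg (fst (\<rho> i))))"
        "snd (\<kappa> i) \<in> B (l + 2 - 2 * int (mdeg (fst (\<kappa> i))))"
        using \<rho>[OF that] \<kappa>[OF that] by (simp_all add: sh_index_def case_prod_beta)
      then show "(\<beta>' i, snd (\<rho> i)) \<in> sh_index c B (l - 1)" "(\<beta> i, snd (\<kappa> i)) \<in> sh_index c B l"
        unfolding shift using \<beta>'[OF that] \<beta>[OF that] by (simp_all add: sh_index_def)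
    qed
    then have "x \<in> toeplitz_minors \<phi> c B r l"
      unfolding toeplitz_minors_def mem_Collect_eq x det[symmetric]
      by (intro exI[of _ "\<lambda>i. (\<beta>' i, snd (\<rho> i))"] exI[of _ "\<lambda>i. (\<beta> i, snd (\<kappa> i))"]) auto
    then show ?thesis by simp
  qed simp
qed

text \<open>
  In degrees at least \<open>d\<close> the Shamash complex is zero in a given degree exactly if all terms of \<open>B\<close> of
  the same parity are, which settles the exceptional clause of \<open>minor_ideal\<close>.
\<close>

lemma sh_basis_empty_iff_periodic:
  assumes c: "c > 0" and length: "\<And>j. B j \<noteq> {} \<Longrightarrow> j \<le> int d" and l: "l \<ge> int d"
  shows "(sh_basis c B l :: ('g, 'r::comm_ring_1) shamash set) = {} \<longleftrightarrow>
    (sh_basis c B (l + 2) :: ('g, 'r) shamash set) = {}"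
proof -
  have index_nonempty: "sh_index c B l \<noteq> {} \<longleftrightarrow> (\<exists>n. B (l - 2 * int n) \<noteq> {})" for l
  proof
    assume "\<exists>n. B (l - 2 * int n) \<noteq> {}"
    then obtain n e where "e \<in> B (l - 2 * int n)" by blast
    then have "(Poly_Mapping.single 0 n, e) \<in> sh_index c B l"
      using c by (auto simp: sh_index_def mdeg_single multi_indices_iff lookup_single)
    then show "sh_index c B l \<noteq> {}" by blast
  qed (auto simp: sh_index_def)
  have "(\<exists>n. B (l - 2 * int n) \<noteq> {}) \<longleftrightarrow> (\<exists>n. B (l + 2 - 2 * int n) \<noteq> {})"
  proof
    assume "\<exists>n. B (l - 2 * int n) \<noteq> {}"
    then obtain n where n: "B (l - 2 * int n) \<noteq> {}" by blast
    have "l + 2 - 2 * int (Suc n) = l - 2 * int n" by simp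
    then show "\<exists>n. B (l + 2 - 2 * int n) \<noteq> {}" using n by metis
  next
    assume "\<exists>n. B (l + 2 - 2 * int n) \<noteq> {}"
    then obtain n where n: "B (l + 2 - 2 * int n) \<noteq> {}" by blast
    then have "n \<noteq> 0" using length[OF n] l by auto
    then have "l + 2 - 2 * int n = l - 2 * int (n - 1)" by (cases n) auto
    then show "\<exists>n. B (l - 2 * int n) \<noteq> {}" using n by metis
  qed
  then show ?thesis using index_nonempty unfolding sh_basis_eq_image image_is_empty by blast
qed

theorem corollary3p20:
  fixes \<mm> :: "'s::comm_ring_1 set" and f :: "nat \<Rightarrow> 's" and c d r :: nat and l :: int
    and \<pi> :: "'s \<Rightarrow> 'r::comm_ring_1"
    and scM :: "'r \<Rightarrow> 'm::ab_group_add \<Rightarrow> 'm"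
    and scG :: "'s \<Rightarrow> 'g::ab_group_add \<Rightarrow> 'g" and B :: "int \<Rightarrow> 'g set"
    and dG :: "'g \<Rightarrow> 'g" and \<epsilon> :: "'g \<Rightarrow> 'm"
    and \<sigma> :: "multi_index \<Rightarrow> 'g \<Rightarrow> 'g"
  assumes "regular_local_ring \<mm>" and "krull_dim TYPE('s) = enat d"
    and "regular_sequence f c" and "c > 1"
    and "quotient_projection \<pi> (ideal_gen (f ` {..<c}))"
    and "fin_gen_module scM"
    and "minimal_free_resolution \<mm> scG B dG (\<lambda>s. scM (\<pi> s)) \<epsilon>"
    and "higher_homotopies f c scG B dG \<sigma>"
    and "r \<ge> 1"
    and "l \<ge> int (r * d + 4 * (r - 1) + 1)"
  shows "minor_ideal sh_scale (sh_basis c B) (sh_diff \<pi> scG B \<sigma>) r l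
       = minor_ideal sh_scale (sh_basis c B) (sh_diff \<pi> scG B \<sigma>) r (l + 2)"
proof -
  note res = assms(7)
  have scG: "Modules.module scG"
    using res by (auto simp: minimal_free_resolution_def graded_free_def)
  interpret Modules.module scG by (rule scG)
  interpret graded_free_module scG B
    using res by unfold_locales (auto simp: minimal_free_resolution_def)
  have neg: "\<forall>j<0. B j = {}" using res by (simp add: minimal_free_resolution_def)
  have length: "0 \<le> j \<and> j \<le> int d" if "B j \<noteq> {}" for j
    using that neg minimal_free_resolution_length_le_dim[OF assms(1,2) res, of j] by (meson not_le)
  have "\<pi> 0 = 0"
    using assms(5) ring_ideal_0[OF ring_ideal_ideal_gen] unfolding quotient_projection_def by blast
  define \<phi> where "\<phi> = (\<lambda>a e' e. \<pi> (coord (\<sigma> a e) e'))"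
  have degree: "e' \<in> B (i + 2 * int (mdeg a) - 1)"
    if "a \<in> multi_indices c" "e \<in> B i" "\<phi> a e' e \<noteq> 0" for a i e e'
  proof -
    have "\<sigma> a e \<in> span (B (i + 2 * int (mdeg a) - 1))"
      using assms(8) that(1) span_base[OF that(2)] unfolding higher_homotopies_def by blast
    moreover have "coord (\<sigma> a e) e' \<noteq> 0" using that(3) \<open>\<pi> 0 = 0\<close> by (auto simp: \<phi>_def)
    ultimately show ?thesis by (rule coord_piece)
  qed
  have "ideal_gen (toeplitz_minors \<phi> c B r (l + 2)) \<subseteq> ideal_gen (toeplitz_minors \<phi> c B r l)"
  proof (rule ideal_gen_minimal[OF _ ring_ideal_ideal_gen])
    have "insert 0 (toeplitz_minors \<phi> c B r l) \<subseteq> ideal_gen (toeplitz_minors \<phi> c B r l)"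
      by (auto intro: ideal_gen_base ring_ideal_0 ring_ideal_ideal_gen)
    moreover have "toeplitz_minors \<phi> c B r (l + 2) \<subseteq> insert 0 (toeplitz_minors \<phi> c B r l)"
      using assms(4,10) length degree by (intro toeplitz_minors_descend)
    ultimately show "toeplitz_minors \<phi> c B r (l + 2) \<subseteq> ideal_gen (toeplitz_minors \<phi> c B r l)"
      by blast
  qed
  moreover have "ideal_gen (toeplitz_minors \<phi> c B r l) \<subseteq> ideal_gen (toeplitz_minors \<phi> c B r (l + 2))"
    using toeplitz_minors_mono[of c] assms(4) by (intro ideal_gen_mono) simp
  ultimately have gen_eq: "ideal_gen (minors sh_scale (sh_basis c B) (sh_diff \<pi> scG B \<sigma>) r l) =
      ideal_gen (minors sh_scale (sh_basis c B) (sh_diff \<pi> scG B \<sigma>) r (l + 2))"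
    unfolding ideal_gen_sh_minors[of \<pi>, OF \<open>\<pi> 0 = 0\<close> neg] \<phi>_def by blast
  have "1 * d \<le> r * d" using assms(9) by (intro mult_le_mono1)
  then have "int d \<le> int (r * d + 4 * (r - 1))" unfolding of_nat_le_iff by linarith
  then have "l - 1 \<ge> int d" using assms(10) by linarith
  then have "(sh_basis c B l :: ('g, 'r) shamash set) = {} \<longleftrightarrow> (sh_basis c B (l + 2) :: ('g, 'r) shamash set) = {}"
    "(sh_basis c B (l - 1) :: ('g, 'r) shamash set) = {} \<longleftrightarrow> (sh_basis c B (l - 1 + 2) :: ('g, 'r) shamash set) = {}"
    using assms(4) length by (intro sh_basis_empty_iff_periodic[of c B d]; auto)+
  then show ?thesis unfolding minor_ideal_def using gen_eq by (simp add: algebra_simps)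
qed

end
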